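(* Let $\chi$ be a nonlinear kernel with data $(L,\psi,\alpha,\beta)$ relative to $\Pi=(t_k)_{k\in\mathbb{Z}}$. Let $\varphi$ be a convex $\varphi$-function, and suppose that there is a convex $\varphi$-function $\eta$ such that for every $\lambda\in(0,1)$ there is a constant $C_\lambda\in(0,1)$ with $\varphi(C_\lambda\psi(u))\le\eta(\lambda u)$ for every $u\in\mathbb{R}^+_0$. If $f\in L^{\varphi+\eta}_\mu(\mathbb{R}^+)$, then there exists $c>0$ such that $$\lim_{w\to+\infty}I^\varphi_\mu\big[c\,(K^\chi_wf-f)\big]=0.$$
   Context: Notation: $\mathbb{R}^+=(0,\infty)$, $\mathbb{R}^+_0=[0,\infty)$; $\mu$ is the logarithmic (Haar) measure $\mu(A)=\int_A \frac{dt}{t}$ on $\mathbb{R}^+$, and $L^1_\mu(\mathbb{R}^+)$ the corresponding Lebesgue space. A $\varphi$-function is a function $\varphi:\mathbb{R}^+_0\to\mathbb{R}^+_0$ that is non-decreasing and continuous, with $\varphi(0)=0$, $\varphi(u)>0$ for $u>0$, and $\varphi(u)\to+\infty$ as $u\to+\infty$. The associated modular is $I^\varphi_\mu[f]:=\int_0^{+\infty}\varphi(|f(x)|)\frac{dx}{x}$ for measurable $f:\mathbb{R}^+\to\mathbb{R}$, and the Mellin-Orlicz space is $L^\varphi_\mu(\mathbb{R}^+):=\{f \text{ measurable}: I^\varphi_\mu[\lambda f]<+\infty\text{ for some }\lambda>0\}$; $L^{\varphi+\eta}_\mu(\mathbb{R}^+)$ is the Mellin-Orlicz space generated by the $\varphi$-function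 $\varphi+\eta$. $\Pi=(t_k)_{k\in\mathbb{Z}}$ is a sequence of real numbers with $t_k<t_{k+1}$, $\lim_{k\to\pm\infty}t_k=\pm\infty$, for which there are constants $\Delta,\delta>0$ with $\delta\le\Delta_k:=t_{k+1}-t_k\le\Delta$ for every $k\in\mathbb{Z}$. A nonlinear kernel with data $(L,\psi,\alpha,\beta)$, where $L:\mathbb{R}^+\to\mathbb{R}^+_0$ is measurable, $\psi:\mathbb{R}^+_0\to\mathbb{R}^+_0$ is non-decreasing and continuous with $\psi(0)=0$, and $\alpha,\beta>0$, is a function $\chi:\mathbb{R}^+\times\mathbb{R}\to\mathbb{R}$ such that: (1) $(\chi(e^{-t_k}x^w,u))_k\in\ell^1(\mathbb{Z})$ for every $x\in\mathbb{R}^+$, $u\in\mathbb{R}$, $w>0$; (2) $\chi(x,0)=0$ for every $x\in\mathbb{R}^+$; (3) $|\chi(x,u)-\chi(x,v)|\le L(x)\,\psi(|u-v|)$ for every $x\in\mathbb{R}^+$, $u,v\in\mathbb{R}$; (4) for every $j\in\mathbb{N}$ ($j\ge1$), $$\mathcal{S}^j_w(x):=\sup_{0\le|u|<1/j}\Big|\sum_{k\in\mathbb{Z}}\chi(e^{-t_k}x^w,u)-u\Big|=\mathcal{O}(w^{-\alpha}),\qquad \mathcal{T}^j_w(x):=\sup_{|u|\ge1/j}\Big|\frac1u\sum_{k\in\mathbb{Z}}\chi(e^{-t_k}x^w,u)-1\Big|=\mathcal{O}(w^{-\alpha})$$ as $w\to+\infty$, uniformly with respect to $x\in\mathbb{R}^+$;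 (5) $L\in L^1_\mu(\mathbb{R}^+)$ and $L$ is bounded; (6) $M_{\beta,\Pi}(L)<+\infty$, where $M_{\beta,\Pi}(L):=\sup_{x\in\mathbb{R}^+}\sum_{k\in\mathbb{Z}}L(e^{-t_k}x)\,|\ln x-t_k|^\beta$. For $w>0$ and a locally integrable $f:\mathbb{R}^+\to\mathbb{R}$ for which the series converges for every $x$, the nonlinear exponential Kantorovich sampling operator is $$(K^\chi_w f)(x):=\sum_{k\in\mathbb{Z}}\chi\Big(e^{-t_k}x^w,\ \frac{w}{\Delta_k}\int_{t_k/w}^{t_{k+1}/w}f(e^u)\,du\Big),\qquad x\in\mathbb{R}^+.$$ *)

theory Defs
  imports "HOL-Analysis.Analysis"
begin

text \<open>Functions on the positive (or nonnegative) half-line are modelled as functions on the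
  type of reals; every definition below only inspects their values on the relevant half-line.\<close>

definition haar :: "real measure" where
  "haar = density (lebesgue_on {0<..}) (\<lambda>t. ennreal (1 / t))"

definition phi_function :: "(real \<Rightarrow> real) \<Rightarrow> bool" where
  "phi_function \<phi> \<longleftrightarrow>
     mono_on {0..} \<phi> \<and> continuous_on {0..} \<phi> \<and> \<phi> 0 = 0 \<and> (\<forall>u>0. \<phi> u > 0) \<and>
     filterlim \<phi> at_top at_top"

text \<open>The modular takes values in the extended nonnegative reals. For an integrand that is not
  measurable, the library integral is the supremum over the simple functions below it. This can
  only matter for a sampling series whose kernel is not measurable in its first argument, as no
  such measurability is part of the definition of a kernel.\<close>

definition modular :: "(real \<Rightarrow> real) \<Rightarrow> (real \<Rightarrow> real) \<Rightarrow> ennreal" where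
  "modular \<phi> f = (\<integral>\<^sup>+ x. ennreal (\<phi> \<bar>f x\<bar>) \<partial>haar)"

definition mellin_orlicz :: "(real \<Rightarrow> real) \<Rightarrow> (real \<Rightarrow> real) set" where
  "mellin_orlicz \<phi> =
     {f. f \<in> borel_measurable haar \<and> (\<exists>a>0. modular \<phi> (\<lambda>x. a * f x) < \<infinity>)}"

definition sampling_nodes :: "(int \<Rightarrow> real) \<Rightarrow> bool" where
  "sampling_nodes t \<longleftrightarrow>
     (\<forall>k. t k < t (k + 1)) \<and> filterlim t at_top at_top \<and> filterlim t at_bot at_bot \<and>
     (\<exists>\<Delta>>0. \<exists>\<delta>>0. \<forall>k. \<delta> \<le> t (k + 1) - t k \<and> t (k + 1) - t k \<le> \<Delta>)"

text \<open>The suprema \<open>S\<close>, \<open>T\<close> and the absolute moment below may be infinite, hence the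
  extended nonnegative values.\<close>

definition S_err ::
  "(int \<Rightarrow> real) \<Rightarrow> (real \<Rightarrow> real \<Rightarrow> real) \<Rightarrow> nat \<Rightarrow> real \<Rightarrow> real \<Rightarrow> ennreal" where
  "S_err t \<kappa> j w x =
     (SUP u\<in>{u. 0 \<le> \<bar>u\<bar> \<and> \<bar>u\<bar> < 1 / real j}.
        ennreal \<bar>(\<Sum>\<^sub>\<infinity>k\<in>UNIV. \<kappa> (exp (- t k) * x powr w) u) - u\<bar>)"

definition T_err ::
  "(int \<Rightarrow> real) \<Rightarrow> (real \<Rightarrow> real \<Rightarrow> real) \<Rightarrow> nat \<Rightarrow> real \<Rightarrow> real \<Rightarrow> ennreal" where
  "T_err t \<kappa> j w x =
     (SUP u\<in>{u. \<bar>u\<bar> \<ge> 1 / real j}.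
        ennreal \<bar>1 / u * (\<Sum>\<^sub>\<infinity>k\<in>UNIV. \<kappa> (exp (- t k) * x powr w) u) - 1\<bar>)"

definition uniform_bigo :: "(real \<Rightarrow> real \<Rightarrow> ennreal) \<Rightarrow> real \<Rightarrow> bool" where
  "uniform_bigo F \<alpha> \<longleftrightarrow>
     (\<exists>C. \<forall>\<^sub>F w in at_top. \<forall>x>0. F w x \<le> ennreal (C * w powr (- \<alpha>)))"

definition abs_moment :: "real \<Rightarrow> (int \<Rightarrow> real) \<Rightarrow> (real \<Rightarrow> real) \<Rightarrow> ennreal" where
  "abs_moment \<beta> t L =
     (SUP x\<in>{0<..}. \<Sum>\<^sub>\<infinity>k\<in>UNIV. ennreal (L (exp (- t k) * x) * \<bar>ln x - t k\<bar> powr \<beta>))"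

definition kernel_data :: "(real \<Rightarrow> real) \<Rightarrow> (real \<Rightarrow> real) \<Rightarrow> real \<Rightarrow> real \<Rightarrow> bool" where
  "kernel_data L \<psi> \<alpha> \<beta> \<longleftrightarrow>
     L \<in> borel_measurable haar \<and> (\<forall>x>0. L x \<ge> 0) \<and>
     (\<forall>u\<ge>0. \<psi> u \<ge> 0) \<and> mono_on {0..} \<psi> \<and> continuous_on {0..} \<psi> \<and> \<psi> 0 = 0 \<and>
     \<alpha> > 0 \<and> \<beta> > 0"

definition nonlinear_kernel ::
  "(int \<Rightarrow> real) \<Rightarrow> (real \<Rightarrow> real) \<Rightarrow> (real \<Rightarrow> real) \<Rightarrow> real \<Rightarrow> real \<Rightarrow>
   (real \<Rightarrow> real \<Rightarrow> real) \<Rightarrow> bool" where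
  "nonlinear_kernel t L \<psi> \<alpha> \<beta> \<kappa> \<longleftrightarrow>
     kernel_data L \<psi> \<alpha> \<beta> \<and>
     (\<forall>x>0. \<forall>u. \<forall>w>0. (\<lambda>k. \<bar>\<kappa> (exp (- t k) * x powr w) u\<bar>) summable_on UNIV) \<and>
     (\<forall>x>0. \<kappa> x 0 = 0) \<and>
     (\<forall>x>0. \<forall>u v. \<bar>\<kappa> x u - \<kappa> x v\<bar> \<le> L x * \<psi> \<bar>u - v\<bar>) \<and>
     (\<forall>j\<ge>1. uniform_bigo (S_err t \<kappa> j) \<alpha> \<and> uniform_bigo (T_err t \<kappa> j) \<alpha>) \<and>
     integrable haar L \<and> bounded (L ` {0<..}) \<and>
     abs_moment \<beta> t L < \<infinity>"

text \<open>For \<open>f\<close> in a Mellin-Orlicz space of a convex \<open>\<phi>\<close>-function, the local means are well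
  defined and, for a fixed \<open>w\<close>, bounded in \<open>k\<close>; so for a nonlinear kernel the series below
  converges absolutely and the default values of the integral and of the sum never intervene.\<close>

definition kantorovich ::
  "(int \<Rightarrow> real) \<Rightarrow> (real \<Rightarrow> real \<Rightarrow> real) \<Rightarrow> real \<Rightarrow> (real \<Rightarrow> real) \<Rightarrow> real \<Rightarrow> real" where
  "kantorovich t \<kappa> w f x =
     (\<Sum>\<^sub>\<infinity>k\<in>UNIV. \<kappa> (exp (- t k) * x powr w)
        (w / (t (k + 1) - t k) * (LINT u:{t k / w..t (k + 1) / w}|lebesgue. f (exp u))))"

end

theory Submission
  imports Defs "HOL-Probability.Probability_Measure" "HOL-Library.Nat_Bijection"
begin

text \<open>In the variable \<open>s = ln x\<close> the Haar measure becomes Lebesgue measure; write \<open>g s = f (exp s)\<close>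
  and \<open>l s = L (exp s)\<close>. The error at \<open>s\<close> is at most
  \<open>(\<Sum>k. l (w s - t k) * \<psi> \<bar>mean k - g s\<bar>) + E\<close>, where \<open>mean k\<close> is the local mean of \<open>g\<close> over the
  \<open>k\<close>-th cell and \<open>E\<close> is the error of the discrete kernel sum at the fixed value \<open>u = g s\<close>.

  The part \<open>E\<close> tends to \<open>0\<close> pointwise by the case \<open>j = 1\<close> of the approximation conditions, and is
  dominated by \<open>A * \<psi> \<bar>u\<bar> + \<bar>u\<bar>\<close> with \<open>A\<close> a bound for the sums of \<open>l\<close> over the shifted nodes.

  For the first part, Jensen's inequality for the sum and for the means bounds its modular by a double
  integral of \<open>\<eta> (a * \<bar>g u - g s\<bar>)\<close> against the kernel. Since \<open>\<eta>\<close> is superadditive, this is at most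
  \<open>\<bar>H u - H s\<bar>\<close> for the integrable function \<open>H = sgn g * \<eta> (2 a \<bar>g\<bar>)\<close>. Nodes with
  \<open>\<bar>w s - t k\<bar> \<le> R\<close> contribute little by the continuity of translations in \<open>L\<^sup>1\<close>; the others by the
  integrability of \<open>l\<close> (for the term \<open>H u\<close>) and its finite moment (for the term \<open>H s\<close>). The
  sampling series need not be measurable, so everything is dominated pointwise by Borel functions
  before integrating.\<close>

section \<open>Sums over the integers as integrals against counting measure\<close>

text \<open>Enumerating the integers by \<open>int_decode\<close> turns the integral into a series
  over the naturals, whose partial sums are sums over finite sets of integers. Writing sums over the
  nodes as integrals makes Tonelli's theorem available for them.\<close>

lemma nn_integral_count_space_int_le:
  fixes f :: "int \<Rightarrow> ennreal"
  assumes "\<And>F. finite F \<Longrightarrow> sum f F \<le> C"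
  shows "(\<integral>\<^sup>+ k. f k \<partial>count_space UNIV) \<le> C"
proof -
  have "(\<integral>\<^sup>+ k. f k \<partial>count_space UNIV) = (\<integral>\<^sup>+ n. f (int_decode n) \<partial>count_space UNIV)"
    by (rule nn_integral_bij_count_space[symmetric]) (rule bij_int_decode)
  also have "\<dots> = (SUP N. \<Sum>n<N. f (int_decode n))"
    by (simp add: nn_integral_count_space_nat suminf_eq_SUP)
  also have "\<dots> \<le> C"
  proof (rule SUP_least)
    fix N
    have "(\<Sum>n<N. f (int_decode n)) = sum f (int_decode ` {..<N})"
      by (subst sum.reindex) (auto intro: inj_on_subset[OF inj_int_decode])
    then show "(\<Sum>n<N. f (int_decode n)) \<le> C" using assms by simp
  qed
  finally show ?thesis .
qed

lemma sum_le_nn_integral_count_space: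
  fixes f :: "'a \<Rightarrow> ennreal"
  assumes "finite F"
  shows "sum f F \<le> (\<integral>\<^sup>+ k. f k \<partial>count_space UNIV)"
proof -
  have "sum f F = (\<integral>\<^sup>+ k. f k * indicator F k \<partial>count_space UNIV)"
    using assms by (subst nn_integral_count_space'[where A=F]) auto
  also have "\<dots> \<le> (\<integral>\<^sup>+ k. f k \<partial>count_space UNIV)"
    by (intro nn_integral_mono) (auto simp: indicator_def)
  finally show ?thesis .
qed

section \<open>Haar measure in the logarithmic variable\<close>

lemma space_haar [simp]: "space haar = {0<..}"
  by (simp add: haar_def)

lemma measurable_haar_borelI:
  assumes "h \<in> borel \<rightarrow>\<^sub>M M"
  shows "h \<in> haar \<rightarrow>\<^sub>M M"
proof -
  have "h \<in> lebesgue \<rightarrow>\<^sub>M M" using measurable_completion[of h lborel M] assms by simp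
  then have "h \<in> lebesgue_on {0<..} \<rightarrow>\<^sub>M M" by (rule measurable_restrict_space1)
  then show ?thesis by (simp add: haar_def)
qed

text \<open>The density 1/x has the antiderivative \<open>ln\<close>, so the preimage of the
  interval from \<open>l\<close> to \<open>u\<close> has measure u - l, and Lebesgue measure is
  determined by its values on boxes.\<close>

lemma distr_haar_ln: "distr haar borel ln = lborel"
proof (rule lborel_eqI[symmetric])
  show "sets (distr haar borel ln) = sets borel" by simp
next
  fix l u :: real assume "\<And>b. b \<in> Basis \<Longrightarrow> l \<bullet> b \<le> u \<bullet> b"
  then have lu: "l \<le> u" by simp
  have [measurable]: "ln \<in> haar \<rightarrow>\<^sub>M borel" by (rule measurable_haar_borelI) simp
  have eq: "ln -` box l u \<inter> space haar = {exp l<..<exp u}"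
  proof (intro set_eqI iffI)
    fix x assume "x \<in> ln -` box l u \<inter> space haar"
    then show "x \<in> {exp l<..<exp u}"
      using exp_less_cancel_iff[of l "ln x"] exp_less_cancel_iff[of "ln x" u] by auto
  next
    fix x assume x: "x \<in> {exp l<..<exp u}"
    then have "0 < x" by (auto intro: order.strict_trans[OF exp_gt_zero])
    then show "x \<in> ln -` box l u \<inter> space haar"
      using x exp_less_cancel_iff[of l "ln x"] exp_less_cancel_iff[of "ln x" u] by auto
  qed
  have "emeasure (distr haar borel ln) (box l u) = emeasure haar {exp l<..<exp u}"
    by (subst emeasure_distr) (simp_all only: eq, simp_all)
  also have "\<dots> = (\<integral>\<^sup>+ x. ennreal (1 / x) * indicator {exp l<..<exp u} x \<partial>lebesgue_on {0<..})"
    unfolding haar_def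
    by (intro emeasure_density) (auto simp: sets_restrict_space_iff intro!: measurable_restrict_space1 measurable_completion intro: order.strict_trans[OF exp_gt_zero])
  also have "\<dots> = (\<integral>\<^sup>+ x. (ennreal (1 / x) * indicator {exp l<..<exp u} x) * indicator {0<..} x \<partial>lborel)"
    by (subst nn_integral_restrict_space) (auto simp: nn_integral_completion)
  \<comment> \<open>The fundamental theorem of calculus is applied on a closed interval. The two
    endpoints form a null set, and \<open>exp l \<le> x\<close> already forces \<open>x\<close> to
    be positive.\<close>
  also have "\<dots> = (\<integral>\<^sup>+ x. ennreal (1 / x) * indicator {exp l..exp u} x \<partial>lborel)"
  proof (intro nn_integral_cong_AE)
    have "AE x in lborel. x \<noteq> exp l" "AE x in lborel. x \<noteq> exp u"
      by (rule AE_lborel_singleton)+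
    then show "AE x in lborel. ennreal (1 / x) * indicator {exp l<..<exp u} x * indicator {0<..} x
        = ennreal (1 / x) * indicator {exp l..exp u} x"
    proof eventually_elim
      fix x assume "x \<noteq> exp l" "x \<noteq> exp u"
      moreover have "0 < x" if "exp l \<le> x" using that by (meson exp_gt_zero order.strict_trans2)
      ultimately show "ennreal (1 / x) * indicator {exp l<..<exp u} x * indicator {0<..} x
        = ennreal (1 / x) * indicator {exp l..exp u} x" 
        by (cases "exp l \<le> x") (auto simp: indicator_def)
    qed
  qed
  also have "\<dots> = ennreal (ln (exp u) - ln (exp l))"
  proof (rule nn_integral_FTC_Icc)
    fix x assume "x \<in> {exp l..exp u}"
    then have "0 < x" by (auto intro: order.strict_trans2[OF exp_gt_zero])
    then show "DERIV ln x :> 1 / x" "0 \<le> 1 / x" by (auto intro!: derivative_eq_intros)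
  qed (use lu in auto)
  finally show "emeasure (distr haar borel ln) (box l u) = ennreal (\<Prod>b\<in>Basis. (u - l) \<bullet> b)"
    by simp
qed

lemma nn_integral_haar_ln:
  assumes "D \<in> borel_measurable borel"
  shows "(\<integral>\<^sup>+ x. D (ln x) \<partial>haar) = (\<integral>\<^sup>+ s. D s \<partial>lborel)"
  using assms by (subst distr_haar_ln[symmetric], subst nn_integral_distr)
    (auto intro: measurable_haar_borelI)

text \<open>\<open>P\<close> is arbitrary, so its exceptional set may fail to be measurable. Each
  direction covers that set by a Borel null set and transports the cover along \<open>ln\<close>.
  The forward direction uses that the density 1/t is positive, so a Haar-null set is Lebesgue-null
  in the half-line.\<close>

lemma AE_haar_iff: "(AE x in haar. P x) \<longleftrightarrow> (AE s in lborel. P (exp s))"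
proof
  assume "AE x in haar. P x"
  then have "AE x in lebesgue_on {0<..}. 0 < ennreal (1 / x) \<longrightarrow> P x"
    unfolding haar_def
    by (subst (asm) AE_density) (auto intro!: measurable_restrict_space1 measurable_completion)
  then have "AE x in lborel. x \<in> {0<..} \<longrightarrow> 0 < ennreal (1 / x) \<longrightarrow> P x"
    by (subst (asm) AE_restrict_space_iff) (auto simp: AE_completion_iff)
  then obtain N where N: "{x. \<not> (x \<in> {0<..} \<longrightarrow> 0 < ennreal (1 / x) \<longrightarrow> P x)} \<subseteq> N"
      and N0: "N \<in> null_sets lborel"
    unfolding eventually_ae_filter by auto
  then have [measurable]: "N \<in> sets borel" by auto
  have "AE x in lborel. x \<notin> N" using N0 by (rule AE_not_in)
  then have "AE x in haar. x \<notin> N"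
    unfolding haar_def
    by (subst AE_density)
      (auto intro!: measurable_restrict_space1 measurable_completion
         simp: AE_restrict_space_iff AE_completion_iff)
  then have "AE x in haar. exp (ln x) \<notin> N"
    using AE_space[of haar] by eventually_elim simp
  then have "AE s in distr haar borel ln. exp s \<notin> N"
    by (subst AE_distr_iff) (auto intro: measurable_haar_borelI)
  then have "AE s in lborel. exp s \<notin> N" unfolding distr_haar_ln .
  then show "AE s in lborel. P (exp s)"
  proof eventually_elim
    fix s assume "exp s \<notin> N"
    then have "exp s \<in> {0<..} \<longrightarrow> 0 < ennreal (1 / exp s) \<longrightarrow> P (exp s)" using N by blast
    then show "P (exp s)" by simp
  qed
next
  assume "AE s in lborel. P (exp s)"
  then obtain N where N: "{s. \<not> P (exp s)} \<subseteq> N" and N0: "N \<in> null_sets lborel"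
    unfolding eventually_ae_filter by auto
  have [measurable]: "N \<in> sets borel" using N0 by auto
  have "AE s in distr haar borel ln. s \<notin> N"
    unfolding distr_haar_ln using N0 by (rule AE_not_in)
  then have "AE x in haar. ln x \<notin> N"
    by (subst (asm) AE_distr_iff) (auto intro: measurable_haar_borelI)
  then show "AE x in haar. P x"
    using AE_space[of haar] by eventually_elim (use N in force)
qed

text \<open>Haar measurability is Lebesgue measurability on the half-line, while the changes of
  variable and the Tonelli arguments below work with Borel functions. Extension by zero gives a
  Lebesgue measurable function on the line; a Borel version of it stays Borel after composition with
  \<open>exp\<close>.\<close>

lemma haar_borel_representative:
  fixes h :: "real \<Rightarrow> real"
  assumes "h \<in> borel_measurable haar"
  obtains g where "g \<in> borel_measurable borel" "AE s in lborel. h (exp s) = g s"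
proof -
  have "h \<in> borel_measurable (lebesgue_on {0<..})"
    using assms by (simp add: haar_def)
  then have "(\<lambda>x. if x \<in> {0<..} then h x else 0) \<in> borel_measurable lebesgue"
    by (subst borel_measurable_if) auto
  then obtain h' where h': "h' \<in> borel_measurable lborel"
      and eq: "AE x in lborel. (if x \<in> {0<..} then h x else 0) = h' x"
    using completion_ex_borel_measurable_real by blast
  have "AE x in haar. h x = h' x"
    unfolding haar_def using eq
    by (subst AE_density)
      (auto intro!: measurable_restrict_space1 measurable_completion
         simp: AE_restrict_space_iff AE_completion_iff)
  then have "AE s in lborel. h (exp s) = h' (exp s)" by (simp add: AE_haar_iff)
  then show ?thesis using that[of "\<lambda>s. h' (exp s)"] h' by simp
qed

section \<open>Affine images of null sets and translations in L^1\<close>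

text \<open>A Borel null set covering the exceptional set of \<open>P\<close> is pulled back by the
  affine map. This later carries the agreement of \<open>L\<close> with its Borel envelope to the
  arguments \<open>w * s - t k\<close>.\<close>

lemma AE_lborel_affine:
  fixes P :: "real \<Rightarrow> bool"
  assumes "AE x in lborel. P x" "c \<noteq> 0"
  shows "AE x in lborel. P (t + c * x)"
proof -
  obtain N where N: "{x. \<not> P x} \<subseteq> N" and N0: "N \<in> null_sets lborel"
    using assms(1) unfolding eventually_ae_filter by auto
  have [measurable]: "N \<in> sets borel" using N0 by auto
  have "AE x in lborel. t + c * x \<notin> N"
    by (rule AE_borel_affine[of c "\<lambda>x. x \<notin> N"]) (use assms(2) AE_not_in[OF N0] in auto)
  then show ?thesis by eventually_elim (use N in auto)
qed

text \<open>Induction over integrable functions. For an indicator, \<open>A\<close> is enclosed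
  between a compact \<open>K\<close> and an open \<open>U\<close> whose difference \<open>D\<close>
  is small; a shift shorter than the distance from \<open>K\<close> to the complement of
  \<open>U\<close> changes membership in \<open>A\<close> only where \<open>s\<close> or
  \<open>s + h\<close> lies in \<open>D\<close>. Sums and dominated limits are handled by splitting
  \<open>e\<close>.\<close>

lemma L1_translation:
  fixes H :: "real \<Rightarrow> real"
  assumes "integrable lborel H" "0 < e"
  shows "\<exists>d>0. \<forall>h. \<bar>h\<bar> < d \<longrightarrow> (\<integral>\<^sup>+ s. ennreal \<bar>H (s + h) - H s\<bar> \<partial>lborel) \<le> ennreal e"
  using assms
proof (induction H arbitrary: e rule: integrable_induct)
  case (base A c)
  \<comment> \<open>\<open>D\<close> is counted twice, at \<open>s\<close> and at
    \<open>s + h\<close>, with weight \<open>\<bar>c\<bar>\<close>, so the total is at most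
    \<open>2 * b * \<bar>c\<bar> \<le> e\<close>; adding 1 in the denominator covers
    \<open>c = 0\<close>.\<close>
  define b where "b = e / (2 * (\<bar>c\<bar> + 1))"
  have b: "b > 0" using base by (simp add: b_def)
  have A [measurable]: "A \<in> sets borel" using base by simp
  have A': "A \<in> sets lebesgue" using A by (rule sets_completionI_sets[of _ lborel, simplified])
  obtain U where U: "open U" "A \<subseteq> U" "emeasure lebesgue (U - A) < ennreal (b/3)"
    by (rule sets_lebesgue_outer_open[OF A', of "b/3"]) (use b in simp)
  obtain C where C: "closed C" "C \<subseteq> A" "emeasure lebesgue (A - C) < ennreal (b/3)"
    by (rule sets_lebesgue_inner_closed[OF A', of "b/3"]) (use b in simp)
  have [measurable]: "U \<in> sets borel" "C \<in> sets borel" using U C by auto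
  \<comment> \<open>The inner approximation \<open>C\<close> is only closed. Cutting it with a large
    ball makes it compact, and the part cut off vanishes by continuity from above because
    \<open>A\<close> has finite measure.\<close>
  have "(\<lambda>n. emeasure lborel (C - cball 0 (real n))) \<longlonglongrightarrow> emeasure lborel (\<Inter>n. C - cball 0 (real n))"
  proof (rule Lim_emeasure_decseq)
    have "emeasure lborel (C - cball 0 (real n)) \<le> emeasure lborel A" for n
      by (rule emeasure_mono) (use C in auto)
    then show "emeasure lborel (C - cball 0 (real n)) \<noteq> \<infinity>" for n
      using base(2) by (metis infinity_ennreal_def not_less_iff_gr_or_eq order_le_less_trans)
  qed (auto simp: decseq_def)
  moreover have "(\<Inter>n. C - cball 0 (real n)) = {}"
    using real_arch_simple by (auto simp: dist_real_def)
  ultimately have "(\<lambda>n. emeasure lborel (C - cball 0 (real n))) \<longlonglongrightarrow> 0"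
    by (simp only: emeasure_empty)
  then have "eventually (\<lambda>n. emeasure lborel (C - cball 0 (real n)) < ennreal (b/3)) sequentially"
    using b by (intro order_tendstoD) auto
  then obtain n where n: "emeasure lborel (C - cball 0 (real n)) < ennreal (b/3)"
    by (auto simp: eventually_sequentially)
  define K where "K = C \<inter> cball 0 (real n)"
  have K: "compact K" "K \<subseteq> A" unfolding K_def using C by (auto intro: closed_Int_compact)
  have [measurable]: "K \<in> sets borel" unfolding K_def by auto
  define D where "D = U - K"
  have [measurable]: "D \<in> sets borel" unfolding D_def by auto
  have "emeasure lborel D \<le> emeasure lborel (U - A) + emeasure lborel (A - C) + emeasure lborel (C - cball 0 (real n))"
  proof -
    have "emeasure lborel D \<le> emeasure lborel ((U - A) \<union> (A - C) \<union> (C - cball 0 (real n)))"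
      by (rule emeasure_mono) (auto simp: D_def K_def)
    also have "\<dots> \<le> emeasure lborel ((U - A) \<union> (A - C)) + emeasure lborel (C - cball 0 (real n))"
      by (rule emeasure_subadditive) auto
    also have "\<dots> \<le> emeasure lborel (U - A) + emeasure lborel (A - C) + emeasure lborel (C - cball 0 (real n))"
      by (intro add_mono emeasure_subadditive) auto
    finally show ?thesis .
  qed
  also have "\<dots> \<le> ennreal (b/3) + ennreal (b/3) + ennreal (b/3)"
    using U(3) C(3) n by (intro add_mono) (auto simp: emeasure_completion)
  also have "\<dots> = ennreal b" using b by (simp flip: ennreal_plus)
  finally have D: "emeasure lborel D \<le> ennreal b" .
  obtain d where d: "d > 0" "\<And>x y. x \<in> K \<Longrightarrow> y \<in> - U \<Longrightarrow> d \<le> dist x y"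
    using separate_compact_closed[of K "- U"] K U by (metis Compl_disjoint2 Int_Un_eq(2) closed_Compl disjoint_eq_subset_Compl double_complement subset_trans)
  show ?case
  proof (intro exI[of _ d] conjI allI impI)
    fix h assume h: "\<bar>h\<bar> < d"
    have sub: "x + k \<in> U" if "x \<in> K" "\<bar>k\<bar> < d" for x k
      using d(2)[of x "x + k"] that by (force simp: dist_real_def)
    have pw: "ennreal \<bar>indicat_real A (s + h) *\<^sub>R c - indicat_real A s *\<^sub>R c\<bar>
        \<le> ennreal \<bar>c\<bar> * (indicator D s + indicator D (s + h))" for s
    proof -
      consider "s \<in> A \<longleftrightarrow> s + h \<in> A" | "s \<in> D" | "s + h \<in> D"
        using sub[of s h] sub[of "s + h" "-h"] h K(2) U(2) unfolding D_def by force
      then show ?thesis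
      proof cases
        case 1 then show ?thesis by (simp add: indicator_def)
      next
        case 2
        have "ennreal \<bar>indicat_real A (s + h) *\<^sub>R c - indicat_real A s *\<^sub>R c\<bar> \<le> ennreal \<bar>c\<bar> * 1"
          by (auto simp: indicator_def)
        also have "\<dots> \<le> ennreal \<bar>c\<bar> * (indicator D s + indicator D (s + h))"
          using 2 by (intro mult_left_mono) auto
        finally show ?thesis .
      next
        case 3
        have "ennreal \<bar>indicat_real A (s + h) *\<^sub>R c - indicat_real A s *\<^sub>R c\<bar> \<le> ennreal \<bar>c\<bar> * 1"
          by (auto simp: indicator_def)
        also have "\<dots> \<le> ennreal \<bar>c\<bar> * (indicator D s + indicator D (s + h))"
          using 3 by (intro mult_left_mono) auto
        finally show ?thesis .
      qed
    qed
    have "(\<integral>\<^sup>+ s. ennreal \<bar>indicat_real A (s + h) *\<^sub>R c - indicat_real A s *\<^sub>R c\<bar> \<partial>lborel)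
        \<le> (\<integral>\<^sup>+ s. ennreal \<bar>c\<bar> * (indicator D s + indicator D (s + h)) \<partial>lborel)"
      by (intro nn_integral_mono pw)
    also have "\<dots> = ennreal \<bar>c\<bar> * (emeasure lborel D + (\<integral>\<^sup>+ s. indicator D (s + h) \<partial>lborel))"
      by (simp add: nn_integral_cmult nn_integral_add)
    also have "(\<integral>\<^sup>+ s. indicator D (s + h) \<partial>lborel) = emeasure lborel D"
      using nn_integral_real_affine[of "indicator D" 1 h] by (simp add: add.commute)
    also have "ennreal \<bar>c\<bar> * (emeasure lborel D + emeasure lborel D) \<le> ennreal \<bar>c\<bar> * (ennreal b + ennreal b)"
      by (intro mult_left_mono add_mono D) auto
    also have "\<dots> = ennreal (\<bar>c\<bar> * (2 * b))"
      using b by (simp flip: ennreal_plus ennreal_mult)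
    also have "\<dots> \<le> ennreal e"
      using base(3) by (intro ennreal_leI) (simp add: b_def field_simps)
    finally show "(\<integral>\<^sup>+ s. ennreal \<bar>indicat_real A (s + h) *\<^sub>R c - indicat_real A s *\<^sub>R c\<bar> \<partial>lborel) \<le> ennreal e" .
  qed (use d in auto)
next
  case (add f g)
  obtain d1 where d1: "d1 > 0" "\<And>h. \<bar>h\<bar> < d1 \<Longrightarrow> (\<integral>\<^sup>+ s. ennreal \<bar>f (s + h) - f s\<bar> \<partial>lborel) \<le> ennreal (e/2)"
    using add(3)[of "e/2"] add.prems by auto
  obtain d2 where d2: "d2 > 0" "\<And>h. \<bar>h\<bar> < d2 \<Longrightarrow> (\<integral>\<^sup>+ s. ennreal \<bar>g (s + h) - g s\<bar> \<partial>lborel) \<le> ennreal (e/2)"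
    using add(4)[of "e/2"] add.prems by auto
  have [measurable]: "f \<in> borel_measurable borel" "g \<in> borel_measurable borel" using add(1,2) by auto
  show ?case
  proof (intro exI[of _ "min d1 d2"] conjI allI impI)
    fix h assume h: "\<bar>h\<bar> < min d1 d2"
    have "(\<integral>\<^sup>+ s. ennreal \<bar>f (s + h) + g (s + h) - (f s + g s)\<bar> \<partial>lborel)
        \<le> (\<integral>\<^sup>+ s. ennreal \<bar>f (s + h) - f s\<bar> + ennreal \<bar>g (s + h) - g s\<bar> \<partial>lborel)"
      by (intro nn_integral_mono) (simp flip: ennreal_plus)
    also have "\<dots> = (\<integral>\<^sup>+ s. ennreal \<bar>f (s + h) - f s\<bar> \<partial>lborel) + (\<integral>\<^sup>+ s. ennreal \<bar>g (s + h) - g s\<bar> \<partial>lborel)"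
      by (intro nn_integral_add) auto
    also have "\<dots> \<le> ennreal (e/2) + ennreal (e/2)"
      by (intro add_mono d1 d2) (use h in auto)
    also have "\<dots> = ennreal e" using add.prems by (simp flip: ennreal_plus)
    finally show "(\<integral>\<^sup>+ s. ennreal \<bar>f (s + h) + g (s + h) - (f s + g s)\<bar> \<partial>lborel) \<le> ennreal e" .
  qed (use d1 d2 in auto)
next
  case (lim f s)
  have [measurable]: "f \<in> borel_measurable borel" "\<And>i. s i \<in> borel_measurable borel"
    using lim.hyps(1) lim.hyps(4) by auto
  have "(\<lambda>n. \<integral>\<^sup>+ x. norm (f x - s n x) \<partial>lborel) \<longlonglongrightarrow> 0"
  proof (rule Bochner_Integration.nn_integral_dominated_convergence_norm[where w="\<lambda>x. 2 * norm (f x)"])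
    show "(\<integral>\<^sup>+ x. ennreal (2 * norm (f x)) \<partial>lborel) < \<infinity>"
      using lim.hyps(4) by (simp add: ennreal_mult' nn_integral_cmult ennreal_mult_less_top integrable_iff_bounded)
  qed (use lim in auto)
  then have "eventually (\<lambda>n. (\<integral>\<^sup>+ x. norm (f x - s n x) \<partial>lborel) < ennreal (e/3)) sequentially"
    using lim.prems by (intro order_tendstoD) auto
  then obtain n where n: "(\<integral>\<^sup>+ x. norm (f x - s n x) \<partial>lborel) < ennreal (e/3)"
    by (auto simp: eventually_sequentially)
  obtain d where d: "d > 0" "\<And>h. \<bar>h\<bar> < d \<Longrightarrow> (\<integral>\<^sup>+ x. ennreal \<bar>s n (x + h) - s n x\<bar> \<partial>lborel) \<le> ennreal (e/3)"
    using lim.IH[of "e/3" n] lim.prems by auto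
  show ?case
  proof (intro exI[of _ d] conjI allI impI)
    fix h assume h: "\<bar>h\<bar> < d"
    \<comment> \<open>By translation invariance the approximation error is the same at
      \<open>x + h\<close> as at \<open>x\<close>, so one index \<open>n\<close> serves every
      shift.\<close>
    have sh: "(\<integral>\<^sup>+ x. norm (f (x+h) - s n (x+h)) \<partial>lborel) = (\<integral>\<^sup>+ x. norm (f x - s n x) \<partial>lborel)"
      using nn_integral_real_affine[of "\<lambda>x. ennreal (norm (f x - s n x))" 1 h] by (simp add: add.commute)
    have "(\<integral>\<^sup>+ x. ennreal \<bar>f (x + h) - f x\<bar> \<partial>lborel)
        \<le> (\<integral>\<^sup>+ x. ennreal (norm (f (x+h) - s n (x+h))) + ennreal \<bar>s n (x + h) - s n x\<bar>
              + ennreal (norm (f x - s n x)) \<partial>lborel)"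
      by (intro nn_integral_mono) (simp flip: ennreal_plus)
    also have "\<dots> = (\<integral>\<^sup>+ x. norm (f x - s n x) \<partial>lborel) + (\<integral>\<^sup>+ x. ennreal \<bar>s n (x + h) - s n x\<bar> \<partial>lborel)
        + (\<integral>\<^sup>+ x. norm (f x - s n x) \<partial>lborel)"
      by (simp add: nn_integral_add sh[unfolded real_norm_def])
    also have "\<dots> \<le> ennreal (e/3) + ennreal (e/3) + ennreal (e/3)"
      by (intro add_mono d h) (use n in auto)
    also have "\<dots> = ennreal e" using lim.prems by (simp flip: ennreal_plus)
    finally show "(\<integral>\<^sup>+ x. ennreal \<bar>f (x + h) - f x\<bar> \<partial>lborel) \<le> ennreal e" .
  qed (use d in auto)
qed

section \<open>Convexity inequalities for \<phi>-functions\<close>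

lemma convex_scale_le:
  fixes \<phi> :: "real \<Rightarrow> real"
  assumes "convex_on {0..} \<phi>" "\<phi> 0 = 0" "0 \<le> x" "0 \<le> c" "c \<le> 1"
  shows "\<phi> (c * x) \<le> c * \<phi> x"
  using convex_onD[OF assms(1), of c 0 x] assms(2-) by simp

text \<open>\<open>x\<close> and \<open>y\<close> are fractions of \<open>x + y\<close>. Scaling
  bounds each value by the same fraction of \<open>\<phi> (x + y)\<close>, and the two fractions add
  up to 1.\<close>

lemma convex_superadditive:
  fixes \<phi> :: "real \<Rightarrow> real"
  assumes "convex_on {0..} \<phi>" "\<phi> 0 = 0" "0 \<le> x" "0 \<le> y"
  shows "\<phi> x + \<phi> y \<le> \<phi> (x + y)"
proof (cases "x + y = 0")
  case True
  then have "x = 0" "y = 0" using assms by auto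
  then show ?thesis using assms by simp
next
  case False
  then have pos: "x + y > 0" using assms by simp
  have "\<phi> (x / (x + y) * (x + y)) \<le> x / (x + y) * \<phi> (x + y)"
    and "\<phi> (y / (x + y) * (x + y)) \<le> y / (x + y) * \<phi> (x + y)"
    by (rule convex_scale_le[OF assms(1,2)]; use assms(3,4) pos in \<open>simp add: divide_le_eq_1\<close>)+
  moreover have "x / (x + y) * \<phi> (x + y) + y / (x + y) * \<phi> (x + y) = \<phi> (x + y)"
    using pos by (simp add: add_divide_distrib[symmetric] distrib_right[symmetric])
  ultimately show ?thesis using pos by simp
qed

text \<open>Jensen's inequality for weights of total mass \<open>P\<close> at most 1: after
  normalising by \<open>P\<close>, the missing mass sits at 0, where \<open>\<phi>\<close>
  vanishes.\<close>

lemma convex_sum_le: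
  fixes \<phi> :: "real \<Rightarrow> real"
  assumes "convex_on {0..} \<phi>" "\<phi> 0 = 0" "finite F"
    and "\<And>k. k \<in> F \<Longrightarrow> 0 \<le> p k" "\<And>k. k \<in> F \<Longrightarrow> 0 \<le> y k" "sum p F \<le> 1"
  shows "\<phi> (\<Sum>k\<in>F. p k * y k) \<le> (\<Sum>k\<in>F. p k * \<phi> (y k))"
proof (cases "sum p F = 0")
  case True
  then have "p k = 0" if "k \<in> F" for k
    using assms(3,4) that sum_nonneg_eq_0_iff by blast
  then show ?thesis using assms(2) by simp
next
  case False
  define P where "P = sum p F"
  have P: "0 < P" "P \<le> 1" 
  proof -
    have "0 \<le> P" unfolding P_def by (rule sum_nonneg) (rule assms(4))
    with False show "0 < P" by (simp add: P_def)
    show "P \<le> 1" using assms(6) by (simp add: P_def)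
  qed
  have "F \<noteq> {}" using False by auto
  have sum1: "(\<Sum>k\<in>F. p k / P) = 1"
    using P by (simp add: P_def flip: sum_divide_distrib)
  have "\<phi> (\<Sum>k\<in>F. (p k / P) *\<^sub>R y k) \<le> (\<Sum>k\<in>F. (p k / P) * \<phi> (y k))"
    by (rule convex_on_sum[OF assms(3) \<open>F \<noteq> {}\<close> assms(1) sum1]) (use P assms(4,5) in auto)
  then have *: "P * \<phi> (\<Sum>k\<in>F. (p k / P) * y k) \<le> P * (\<Sum>k\<in>F. (p k / P) * \<phi> (y k))"
    using P by (intro mult_left_mono) auto
  have "(\<Sum>k\<in>F. p k * y k) = P * (\<Sum>k\<in>F. (p k / P) * y k)"
    using P by (simp add: sum_distrib_left)
  also have "\<phi> \<dots> \<le> P * \<phi> (\<Sum>k\<in>F. (p k / P) * y k)"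
    by (intro convex_scale_le[OF assms(1,2)] sum_nonneg mult_nonneg_nonneg divide_nonneg_pos)
      (use P assms(4,5) in auto)
  also note *
  also have "P * (\<Sum>k\<in>F. (p k / P) * \<phi> (y k)) = (\<Sum>k\<in>F. p k * \<phi> (y k))"
    using P by (simp add: sum_distrib_left)
  finally show ?thesis .
qed

lemma convex_half_sum_le:
  fixes \<phi> :: "real \<Rightarrow> real"
  assumes "convex_on {0..} \<phi>" "0 \<le> x" "0 \<le> y"
  shows "\<phi> ((x + y) / 2) \<le> (\<phi> x + \<phi> y) / 2"
proof -
  have "\<phi> ((1 - 1/2) *\<^sub>R x + (1/2) *\<^sub>R y) \<le> (1 - 1/2) * \<phi> x + 1/2 * \<phi> y"
    by (rule convex_onD[OF assms(1)]) (use assms(2,3) in auto)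
  then show ?thesis by (simp add: field_simps)
qed

lemma phi_functionD:
  assumes "phi_function \<phi>"
  shows "\<phi> 0 = 0" "0 \<le> x \<Longrightarrow> x \<le> y \<Longrightarrow> \<phi> x \<le> \<phi> y" "0 \<le> x \<Longrightarrow> 0 \<le> \<phi> x"
    "0 < x \<Longrightarrow> 0 < \<phi> x"
proof -
  have mono: "mono_on {0..} \<phi>" and zero: "\<phi> 0 = 0" and pos: "\<forall>u>0. \<phi> u > 0"
    using assms unfolding phi_function_def by blast+
  show "\<phi> 0 = 0" by (rule zero)
  show "\<phi> x \<le> \<phi> y" if "0 \<le> x" "x \<le> y"
    using mono_onD[OF mono] that by simp
  show "0 < \<phi> x" if "0 < x" using pos that by blast
  show "0 \<le> \<phi> x" if "0 \<le> x"
    using mono_onD[OF mono, of 0 x] that zero by simp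
qed

lemma continuous_on_phi_abs:
  assumes "phi_function \<phi>"
  shows "continuous_on UNIV (\<lambda>x. \<phi> \<bar>x\<bar>)"
proof (rule continuous_on_compose2[of "{0..}" \<phi>])
  show "continuous_on {0..} \<phi>" using assms unfolding phi_function_def by blast
qed (auto intro: continuous_intros)

lemma phi_abs_measurable:
  assumes "phi_function \<phi>"
  shows "(\<lambda>x. \<phi> \<bar>x\<bar>) \<in> borel_measurable borel"
  by (rule borel_measurable_continuous_onI) (rule continuous_on_phi_abs[OF assms])

text \<open>This replaces the modular modulus of continuity of \<open>g\<close> by the \<open>L\<^sup>1\<close> modulus of
  continuity of \<open>sgn g * \<phi> \<bar>g\<bar>\<close>.\<close>

lemma phi_half_diff_le:
  assumes "phi_function \<phi>" "convex_on {0..} \<phi>"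
  shows "\<phi> (\<bar>a - b\<bar> / 2) \<le> \<bar>sgn a * \<phi> \<bar>a\<bar> - sgn b * \<phi> \<bar>b\<bar>\<bar>"
proof -
  note phi = phi_functionD[OF assms(1)]
  \<comment> \<open>For equal signs monotonicity drops the factor 1/2, and superadditivity applied
    to \<open>(x - y) + y\<close> gives the difference.\<close>
  have same: "\<phi> (\<bar>x - y\<bar> / 2) \<le> \<phi> x - \<phi> y" if "0 \<le> y" "y \<le> x" for x y
  proof -
    have "\<phi> (\<bar>x - y\<bar> / 2) \<le> \<phi> (x - y)" using that by (intro phi) auto
    then show ?thesis
      using convex_superadditive[OF assms(2) phi(1), of "x - y" y] that by simp
  qed
  \<comment> \<open>For opposite signs the distance is a sum of absolute values, and the factor 1/2
    turns it into a midpoint.\<close>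
  have opp: "\<phi> ((x + y) / 2) \<le> \<phi> x + \<phi> y" if "0 \<le> x" "0 \<le> y" for x y
    using convex_half_sum_le[OF assms(2), of x y] phi(3)[of x] phi(3)[of y] that by simp
  consider "0 \<le> a" "0 \<le> b" | "a \<le> 0" "b \<le> 0" | "0 < a" "b < 0" | "a < 0" "0 < b" by linarith
  then show ?thesis
  proof cases
    case 1
    then have "sgn a * \<phi> \<bar>a\<bar> = \<phi> a" "sgn b * \<phi> \<bar>b\<bar> = \<phi> b" by (auto simp: sgn_if phi(1))
    then show ?thesis
      using same[of a b] same[of b a] 1 by (cases "a \<le> b") (auto simp: abs_minus_commute)
  next
    case 2
    then have "sgn a * \<phi> \<bar>a\<bar> = - \<phi> (-a)" "sgn b * \<phi> \<bar>b\<bar> = - \<phi> (-b)" by (auto simp: sgn_if phi(1))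
    then show ?thesis
      using same[of "-a" "-b"] same[of "-b" "-a"] 2 by (cases "a \<le> b") (auto simp: abs_minus_commute)
  next
    case 3
    then show ?thesis using opp[of a "-b"] by (simp add: sgn_if)
  next
    case 4
    then show ?thesis using opp[of "-a" b] by (simp add: sgn_if abs_if)
  qed
qed

text \<open>Convexity with \<open>\<phi> 0 = 0\<close> makes \<open>\<phi> u / u\<close> at least
  \<open>\<phi> 1\<close> for \<open>u > 1\<close>. This linear growth turns a finite modular on a
  cell into integrability there, so that local means are genuine integrals.\<close>

lemma phi_linear_lower:
  assumes "phi_function \<phi>" "convex_on {0..} \<phi>" "0 \<le> u"
  shows "u \<le> 1 + \<phi> u / \<phi> 1"
proof (cases "u \<le> 1")
  case True
  then show ?thesis using phi_functionD(3,4)[OF assms(1)] assms(3) by (smt (verit) divide_nonneg_pos)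
next
  case False
  have "\<phi> (1 / u * u) \<le> 1 / u * \<phi> u"
    using False phi_functionD(1)[OF assms(1)] by (intro convex_scale_le[OF assms(2)]) auto
  then have "u * \<phi> 1 \<le> \<phi> u" using False by (simp add: field_simps)
  then have "u \<le> \<phi> u / \<phi> 1"
    using phi_functionD(4)[OF assms(1), of 1] by (simp add: field_simps)
  then show ?thesis by simp
qed

text \<open>The triangle inequality passes through the monotone \<open>\<phi>\<close>. Convexity on
  the whole line is what Jensen's inequality requires for differences of either sign.\<close>

lemma phi_convex_abs:
  assumes "phi_function \<phi>" "convex_on {0..} \<phi>" "0 \<le> a"
  shows "convex_on UNIV (\<lambda>x. \<phi> (a * \<bar>x\<bar>))"
proof (rule convex_onI)
  fix s x y :: real assume s: "0 < s" "s < 1"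
  have "\<phi> (a * \<bar>(1 - s) *\<^sub>R x + s *\<^sub>R y\<bar>) \<le> \<phi> ((1 - s) * (a * \<bar>x\<bar>) + s * (a * \<bar>y\<bar>))"
  proof (rule phi_functionD(2)[OF assms(1)])
    have "\<bar>(1 - s) *\<^sub>R x + s *\<^sub>R y\<bar> \<le> (1 - s) * \<bar>x\<bar> + s * \<bar>y\<bar>"
      using s abs_triangle_ineq[of "(1 - s) * x" "s * y"] by (simp add: abs_mult)
    from mult_left_mono[OF this assms(3)]
    show "a * \<bar>(1 - s) *\<^sub>R x + s *\<^sub>R y\<bar> \<le> (1 - s) * (a * \<bar>x\<bar>) + s * (a * \<bar>y\<bar>)"
      by (simp add: algebra_simps)
  qed (use assms in simp)
  also have "\<dots> \<le> (1 - s) * \<phi> (a * \<bar>x\<bar>) + s * \<phi> (a * \<bar>y\<bar>)"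
    using convex_onD[OF assms(2), of s "a * \<bar>x\<bar>" "a * \<bar>y\<bar>"] s assms(3) by simp
  finally show "\<phi> (a * \<bar>(1 - s) *\<^sub>R x + s *\<^sub>R y\<bar>) \<le> (1 - s) * \<phi> (a * \<bar>x\<bar>) + s * \<phi> (a * \<bar>y\<bar>)" .
qed simp

text \<open>Jensen's inequality for the uniform probability measure on the interval, applied to
  \<open>g - y\<close>. An infinite right-hand side leaves nothing to prove; a finite one makes
  \<open>g\<close> integrable on the interval. The right-hand side is half-open to match the
  disjoint cells used later.\<close>

lemma phi_mean_le:
  fixes g :: "real \<Rightarrow> real"
  assumes \<phi>: "phi_function \<phi>" "convex_on {0..} \<phi>" and a: "0 < a" and lu: "l < u"
    and g [measurable]: "g \<in> borel_measurable borel"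
  shows "ennreal (\<phi> (a * \<bar>1 / (u - l) * (LINT x:{l..u}|lborel. g x) - y\<bar>))
    \<le> (\<integral>\<^sup>+ x. ennreal (1 / (u - l)) * indicator {l..<u} x * ennreal (\<phi> (a * \<bar>g x - y\<bar>)) \<partial>lborel)"
    (is "_ \<le> ?R")
proof (cases "?R = \<infinity>")
  case True
  then show ?thesis by simp
next
  case False
  define q where "q = (\<lambda>x. \<phi> (a * \<bar>x\<bar>))"
  define p where "p = (\<lambda>x. indicator {l..u} x / (u - l))"
  define M where "M = density lborel (\<lambda>x. ennreal (p x))"
  have q_eq: "q = (\<lambda>x. \<phi> \<bar>a * x\<bar>)" using a by (auto simp: q_def abs_mult)
  have [measurable]: "q \<in> borel_measurable borel"
    unfolding q_eq using phi_abs_measurable[OF \<phi>(1)] by measurable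
  have p [measurable]: "p \<in> borel_measurable borel" unfolding p_def by measurable
  have p0: "0 \<le> p x" for x using lu by (simp add: p_def)
  have q0: "0 \<le> q x" for x using phi_functionD(3)[OF \<phi>(1)] a by (simp add: q_def)
  have "emeasure M (space M) = (\<integral>\<^sup>+ x. ennreal (1 / (u - l)) * indicator {l..u} x \<partial>lborel)"
    unfolding M_def using lu
    by (subst emeasure_density) (auto simp: p_def indicator_def intro!: nn_integral_cong)
  also have "\<dots> = 1"
    using lu by (simp add: nn_integral_cmult flip: ennreal_mult)
  finally interpret prob_space M by (intro prob_spaceI)
  have R: "?R = (\<integral>\<^sup>+ x. ennreal (q (g x - y)) \<partial>M)"
  proof -
    have "?R = (\<integral>\<^sup>+ x. ennreal (p x) * ennreal (q (g x - y)) \<partial>lborel)"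
    \<comment> \<open>The half-open and the closed interval differ only in the null set containing
      \<open>u\<close>.\<close>
    proof (rule nn_integral_cong_AE)
      have "AE x in lborel. x \<noteq> u" by (rule AE_lborel_singleton)
      then show "AE x in lborel. ennreal (1 / (u - l)) * indicator {l..<u} x * ennreal (\<phi> (a * \<bar>g x - y\<bar>))
          = ennreal (p x) * ennreal (q (g x - y))"
        by eventually_elim (auto simp: p_def q_def indicator_def)
    qed
    then show ?thesis unfolding M_def by (subst nn_integral_density) auto
  qed
  have iq: "integrable M (\<lambda>x. q (g x - y))"
    using False R q0 by (intro integrableI_nonneg) (auto simp: M_def less_top)
  \<comment> \<open>The majorant is the linear lower bound for \<open>\<phi>\<close> at
    \<open>a * \<bar>g x - y\<bar>\<close>, divided by \<open>a\<close>.\<close>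
  have X: "integrable M (\<lambda>x. g x - y)"
  proof (rule Bochner_Integration.integrable_bound)
    show "integrable M (\<lambda>x. (1 + q (g x - y) / \<phi> 1) / a)"
      using iq by auto
    have "\<bar>z\<bar> \<le> (1 + q z / \<phi> 1) / a" for z
      using phi_linear_lower[OF \<phi>, of "a * \<bar>z\<bar>"] a by (simp add: q_def field_simps)
    moreover have "0 \<le> (1 + q z / \<phi> 1) / a" for z
      using q0[of z] phi_functionD(3)[OF \<phi>(1), of 1] a by simp
    ultimately show "AE x in M. norm (g x - y) \<le> norm ((1 + q (g x - y) / \<phi> 1) / a)"
      by (simp only: real_norm_def abs_of_nonneg AE_I2)
    show "(\<lambda>x. g x - y) \<in> borel_measurable M" unfolding M_def by measurable
  qed
  have "q (expectation (\<lambda>x. g x - y)) \<le> expectation (\<lambda>x. q (g x - y))"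
    by (rule jensens_inequality[where I=UNIV])
      (use X iq phi_convex_abs[OF \<phi>, of a] a in \<open>auto simp: q_def\<close>)
  moreover have "expectation (\<lambda>x. g x - y) = 1 / (u - l) * (LINT x:{l..u}|lborel. g x) - y"
  proof -
    have "integrable M g" using Bochner_Integration.integrable_add[OF X, of "\<lambda>_. y"] by simp
    then have "expectation (\<lambda>x. g x - y) = expectation g - y" by (simp add: prob_space)
    also have "expectation g = (LINT x|lborel. p x *\<^sub>R g x)"
      unfolding M_def using p0 by (subst integral_density) auto
    also have "\<dots> = (LINT x|lborel. 1 / (u - l) * (indicator {l..u} x *\<^sub>R g x))"
      by (simp add: p_def)
    also have "\<dots> = 1 / (u - l) * (LINT x:{l..u}|lborel. g x)"
      unfolding set_lebesgue_integral_def by (rule integral_mult_right_zero)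
    finally show ?thesis .
  qed
  ultimately have "ennreal (q (1 / (u - l) * (LINT x:{l..u}|lborel. g x) - y))
      \<le> ennreal (expectation (\<lambda>x. q (g x - y)))" by (simp add: ennreal_leI)
  also have "\<dots> = ?R"
    unfolding R using iq q0 by (subst nn_integral_eq_integral) auto
  finally show ?thesis by (simp add: q_def)
qed

section \<open>The oscillation functional and its limit\<close>

text \<open>Density of the uniform distribution on the \<open>k\<close>-th scaled cell. Half-open
  cells are disjoint, and extended values allow Tonelli's theorem without integrability
  conditions.\<close>

definition cell_average_weight :: "(int \<Rightarrow> real) \<Rightarrow> real \<Rightarrow> int \<Rightarrow> real \<Rightarrow> ennreal" where
  "cell_average_weight t w k u =
     ennreal (1 / (t (k + 1) / w - t k / w)) * indicator {t k / w..<t (k + 1) / w} u"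

text \<open>\<open>l\<close> stands for the kernel envelope in the logarithmic variable. By Jensen's
  inequality this integral dominates the modular of the error made when the local means are replaced
  by the point value.\<close>

definition oscillation ::
  "(int \<Rightarrow> real) \<Rightarrow> (real \<Rightarrow> real) \<Rightarrow> (real \<Rightarrow> real) \<Rightarrow> real \<Rightarrow> ennreal" where
  "oscillation t l H w = (\<integral>\<^sup>+ s. \<integral>\<^sup>+ k. ennreal (l (w * s - t k)) *
      (\<integral>\<^sup>+ u. cell_average_weight t w k u * ennreal \<bar>H u - H s\<bar> \<partial>lborel) \<partial>count_space UNIV \<partial>lborel)"

context
  fixes t :: "int \<Rightarrow> real" and \<delta> \<Delta> :: real
  assumes \<delta>: "0 < \<delta>"
    and gap: "\<And>k. \<delta> \<le> t (k + 1) - t k" "\<And>k. t (k + 1) - t k \<le> \<Delta>"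
begin

lemma nodes_separated:
  assumes "k \<le> m"
  shows "\<delta> * real_of_int (m - k) \<le> t m - t k"
  using assms
proof (induction m rule: int_ge_induct)
  case (step i)
  then show ?case using gap(1)[of i] by (simp add: algebra_simps)
qed simp

lemma nodes_mono: "k \<le> m \<Longrightarrow> t k \<le> t m"
  using nodes_separated[of k m] \<delta> mult_nonneg_nonneg[of \<delta> "real_of_int (m - k)"] by linarith

text \<open>The nodes with the smallest and the largest index in \<open>F\<close> are at most
  \<open>2 * r\<close> apart, and consecutive nodes are at least \<open>\<delta>\<close> apart; the
  final 1 counts both ends of the index range.\<close>

lemma card_nodes_near:
  assumes "finite F" "\<And>k. k \<in> F \<Longrightarrow> \<bar>x - t k\<bar> \<le> r" "0 \<le> r"
  shows "real (card F) \<le> 2 * r / \<delta> + 1"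
proof (cases "F = {}")
  case True
  then show ?thesis using assms \<delta> by simp
next
  case False
  define a where "a = Min F"
  define b where "b = Max F"
  have ab: "a \<in> F" "b \<in> F" "a \<le> b" "F \<subseteq> {a..b}"
    using False assms(1) by (auto simp: a_def b_def)
  have "card F \<le> card {a..b}" by (rule card_mono) (use ab in auto)
  then have "real (card F) \<le> real_of_int (b - a) + 1" using ab(3) by simp
  moreover have "\<delta> * real_of_int (b - a) \<le> 2 * r"
    using nodes_separated[OF ab(3)] assms(2)[OF ab(1)] assms(2)[OF ab(2)] by linarith
  then have "real_of_int (b - a) \<le> 2 * r / \<delta>"
    using \<delta> by (simp add: field_simps)
  ultimately show ?thesis by linarith
qed

text \<open>The nodes increase, so the half-open cells are disjoint and a common endpoint is counted
  once.\<close>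

lemma sum_cell_indicator_le:
  assumes "finite F" "0 < w"
  shows "(\<Sum>k\<in>F. indicator {t k / w..<t (k + 1) / w} u :: ennreal) \<le> 1"
proof -
  have "card {k \<in> F. u \<in> {t k / w..<t (k + 1) / w}} \<le> Suc 0"
  proof (rule card_le_Suc0_iff_eq[THEN iffD2], use assms in simp, intro ballI)
    fix k m assume km: "k \<in> {k \<in> F. u \<in> {t k / w..<t (k + 1) / w}}" "m \<in> {k \<in> F. u \<in> {t k / w..<t (k + 1) / w}}"
    have False if "k < m" "t m / w \<le> u" "u < t (k + 1) / w" for k m
    proof -
      have "t (k + 1) / w \<le> t m / w"
        using nodes_mono[of "k + 1" m] that(1) assms(2) by (intro divide_right_mono) auto
      then show False using that by linarith
    qed
    from this[of k m] this[of m k] show "k = m" using km by (cases k m rule: linorder_cases) auto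
  qed
  then have "(of_nat (card {k \<in> F. u \<in> {t k / w..<t (k + 1) / w}}) :: ennreal) \<le> of_nat (Suc 0)"
    by (rule of_nat_mono)
  moreover have "(\<Sum>k\<in>F. indicator {t k / w..<t (k + 1) / w} u :: ennreal)
      = (\<Sum>k\<in>F. if u \<in> {t k / w..<t (k + 1) / w} then 1 else 0)"
    unfolding indicator_def of_bool_def ..
  moreover have "\<dots> = (\<Sum>k\<in>{k \<in> F. u \<in> {t k / w..<t (k + 1) / w}}. 1)"
    by (rule sum.inter_filter[symmetric]) (rule assms(1))
  moreover have "\<dots> = of_nat (card {k \<in> F. u \<in> {t k / w..<t (k + 1) / w}})"
    by (simp only: sum_constant mult_1_right)
  ultimately show ?thesis by (simp only: of_nat_Suc of_nat_0 add_0_right)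
qed

context
  fixes l :: "real \<Rightarrow> real" and B M \<beta> :: real
  assumes l: "\<And>x. 0 \<le> l x" "\<And>x. l x \<le> B"
    and \<beta>: "0 < \<beta>"
    and moment: "\<And>x F. finite F \<Longrightarrow> (\<Sum>k\<in>F. l (x - t k) * \<bar>x - t k\<bar> powr \<beta>) \<le> M"
begin

text \<open>Markov's inequality for the moment: at distance more than \<open>r\<close> the factor
  \<open>\<bar>x - t k\<bar> powr \<beta>\<close> is at least \<open>r powr \<beta>\<close>.\<close>

lemma sum_envelope_far_le:
  assumes "finite F" "0 < r"
  shows "(\<Sum>k\<in>F. l (x - t k) * indicator {v. r < \<bar>v\<bar>} (x - t k)) \<le> M * r powr - \<beta>"
proof -
  have "r powr \<beta> * (\<Sum>k\<in>F. l (x - t k) * indicator {v. r < \<bar>v\<bar>} (x - t k))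
      \<le> (\<Sum>k\<in>F. l (x - t k) * \<bar>x - t k\<bar> powr \<beta>)"
    unfolding sum_distrib_left
  proof (rule sum_mono)
    fix k assume "k \<in> F"
    show "r powr \<beta> * (l (x - t k) * indicator {v. r < \<bar>v\<bar>} (x - t k)) \<le> l (x - t k) * \<bar>x - t k\<bar> powr \<beta>"
    proof (cases "r < \<bar>x - t k\<bar>")
      case True
      then have "r powr \<beta> \<le> \<bar>x - t k\<bar> powr \<beta>" using assms \<beta> by (intro powr_mono2) auto
      from mult_left_mono[OF this l(1)[of "x - t k"]] show ?thesis
        using True by (simp add: ac_simps)
    qed (use l(1)[of "x - t k"] in simp)
  qed
  also have "\<dots> \<le> M" by (rule moment) fact
  finally show ?thesis using assms by (simp add: powr_minus field_simps)
qed

text \<open>At most \<open>2 / \<delta> + 1\<close> nodes lie within distance 1, each contributing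
  at most \<open>B\<close>; the remaining ones are controlled by the moment. The bound is kept at
  least 1 so that dividing weights by it never enlarges them.\<close>

lemma sum_envelope_bounded:
  obtains A where "1 \<le> A" "\<And>x F. finite F \<Longrightarrow> (\<Sum>k\<in>F. l (x - t k)) \<le> A"
proof
  define A where "A = max 1 (B * (2 / \<delta> + 1) + M)"
  show "1 \<le> A" by (simp add: A_def)
  fix x and F :: "int set" assume F: "finite F"
  define N where "N = {k \<in> F. \<bar>x - t k\<bar> \<le> 1}"
  have "0 \<le> B" using l(1)[of 0] l(2)[of 0] by linarith
  have "(\<Sum>k\<in>F. l (x - t k)) = (\<Sum>k\<in>N. l (x - t k)) + (\<Sum>k\<in>F-N. l (x - t k))"
    by (subst sum.subset_diff[of N F]) (use F in \<open>auto simp: N_def\<close>)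
  also have "(\<Sum>k\<in>N. l (x - t k)) \<le> B * (2 / \<delta> + 1)"
  proof -
    have "(\<Sum>k\<in>N. l (x - t k)) \<le> real (card N) * B"
      using l(2) by (intro sum_bounded_above)
    also have "\<dots> \<le> (2 * 1 / \<delta> + 1) * B"
    proof (rule mult_right_mono[OF _ \<open>0 \<le> B\<close>])
      show "real (card N) \<le> 2 * 1 / \<delta> + 1"
        by (rule card_nodes_near[of _ x]) (use F in \<open>auto simp: N_def\<close>)
    qed
    finally show ?thesis by (simp add: mult.commute)
  qed
  also have "(\<Sum>k\<in>F-N. l (x - t k)) = (\<Sum>k\<in>F-N. l (x - t k) * indicator {v. 1 < \<bar>v\<bar>} (x - t k))"
    by (intro sum.cong) (auto simp: N_def)
  also have "\<dots> \<le> M" using sum_envelope_far_le[of "F - N" 1 x] F by simp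
  finally show "(\<Sum>k\<in>F. l (x - t k)) \<le> A" by (simp add: A_def)
qed

context
  fixes H :: "real \<Rightarrow> real"
  assumes H: "integrable lborel H" and lint: "integrable lborel l"
begin

text \<open>The three terms come from nodes near \<open>w * s\<close>, from \<open>H u\<close> at
  far nodes and from \<open>H s\<close> at far nodes. Near nodes force \<open>u\<close> close to
  \<open>s\<close>, so the translation modulus \<open>e\<close> applies. For \<open>H u\<close> the
  integral over \<open>s\<close> produces the tail of \<open>l\<close>; for \<open>H s\<close> the
  sum over the nodes is bounded by the moment.\<close>

lemma oscillation_le:
  assumes w: "0 < w" and R: "0 < R"
    and d: "\<And>h. \<bar>h\<bar> < d \<Longrightarrow> (\<integral>\<^sup>+ s. ennreal \<bar>H (s + h) - H s\<bar> \<partial>lborel) \<le> ennreal e"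
    and e: "0 \<le> e" and wd: "(R + \<Delta>) / w < d"
  shows "oscillation t l H w \<le> ennreal (2 * B * (R + \<Delta>) / \<delta> * e)
     + ennreal (1 / \<delta>) * (\<integral>\<^sup>+ v. ennreal (l v) * indicator {v. R < \<bar>v\<bar>} v \<partial>lborel) * (\<integral>\<^sup>+ s. ennreal \<bar>H s\<bar> \<partial>lborel)
     + ennreal (M * R powr - \<beta>) * (\<integral>\<^sup>+ s. ennreal \<bar>H s\<bar> \<partial>lborel)"
proof -
  have [measurable]: "H \<in> borel_measurable borel" "l \<in> borel_measurable borel"
    using H lint by auto
  have "0 \<le> B" using l(1)[of 0] l(2)[of 0] by linarith
  have "0 < \<Delta>" using gap(1,2)[of 0] \<delta> by linarith
  \<comment> \<open>If \<open>w * s\<close> is within \<open>R\<close> of \<open>t k\<close> and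
    \<open>u\<close> lies in the \<open>k\<close>-th cell, then \<open>w * u\<close> is within
    \<open>R + \<Delta>\<close> of \<open>w * s\<close>.\<close>
  define \<rho> where "\<rho> = (R + \<Delta>) / w"
  have "0 < \<rho>" using R \<open>0 < \<Delta>\<close> w by (simp add: \<rho>_def)
  define m where "m = cell_average_weight t w"
  have [measurable]: "m k \<in> borel_measurable borel" for k
    unfolding m_def cell_average_weight_def[abs_def] by measurable
  define far where "far = (\<lambda>v. ennreal (l v) * indicator {v. R < \<bar>v\<bar>} v)"
  have [measurable]: "far \<in> borel_measurable borel" unfolding far_def by measurable
  define near where "near = (\<lambda>s u. indicator {u. \<bar>u - s\<bar> \<le> \<rho>} u * ennreal \<bar>H u - H s\<bar>)"
  have near_eq: "near = (\<lambda>s u. (if \<bar>u - s\<bar> \<le> \<rho> then 1 else 0) * ennreal \<bar>H u - H s\<bar>)"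
    by (auto simp: near_def fun_eq_iff)
  have [measurable]: "(\<lambda>(s, u). near s u) \<in> borel_measurable (borel \<Otimes>\<^sub>M borel)"
    unfolding near_eq by measurable
  define I where "I = (\<lambda>k u. indicator {t k / w..<t (k + 1) / w} u :: ennreal)"
  have [measurable]: "I k \<in> borel_measurable borel" for k unfolding I_def by measurable
  have len: "\<delta> / w \<le> t (k + 1) / w - t k / w" for k
    using gap(1)[of k] w by (simp add: divide_right_mono flip: diff_divide_distrib)
  have len_pos: "0 < t (k + 1) / w - t k / w" for k
    using len[of k] divide_pos_pos[OF \<delta> w] by linarith
  have m_le: "m k u \<le> ennreal (w / \<delta>) * I k u" for k u
  proof -
    have "1 / (t (k + 1) / w - t k / w) \<le> 1 / (\<delta> / w)"
      by (rule divide_left_mono[OF len]) (use \<delta> w len_pos[of k] in \<open>auto intro!: mult_pos_pos\<close>)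
    then show ?thesis
      unfolding m_def cell_average_weight_def I_def by (intro mult_right_mono ennreal_leI) auto
  qed
  have m_int: "(\<integral>\<^sup>+ u. m k u \<partial>lborel) = 1" for k
  proof -
    have "(\<integral>\<^sup>+ u. m k u \<partial>lborel) = ennreal (1 / (t (k + 1) / w - t k / w)) * ennreal (t (k + 1) / w - t k / w)"
      unfolding m_def cell_average_weight_def using len_pos[of k]
      by (subst nn_integral_cmult) auto
    also have "\<dots> = ennreal (1 / (t (k + 1) / w - t k / w) * (t (k + 1) / w - t k / w))"
      using len_pos[of k] by (intro ennreal_mult[symmetric]) auto
    also have "1 / (t (k + 1) / w - t k / w) * (t (k + 1) / w - t k / w) = 1"
      using len_pos[of k] by (metis less_irrefl nonzero_divide_eq_eq)
    finally show ?thesis by simp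
  qed
  have sumI: "(\<integral>\<^sup>+ k. I k u \<partial>count_space UNIV) \<le> 1" for u
    unfolding I_def by (rule nn_integral_count_space_int_le) (rule sum_cell_indicator_le[OF _ w])
  \<comment> \<open>Near nodes use \<open>l \<le> B\<close> and the cell length bound
    \<open>\<delta> / w\<close>; far nodes use the triangle inequality for
    \<open>\<bar>H u - H s\<bar>\<close>.\<close>
  have pw: "ennreal (l (w * s - t k)) * (m k u * ennreal \<bar>H u - H s\<bar>)
      \<le> ennreal (B * w / \<delta>) * (I k u * near s u)
        + far (w * s - t k) * (m k u * ennreal \<bar>H u\<bar>)
        + far (w * s - t k) * (m k u * ennreal \<bar>H s\<bar>)" (is "?L \<le> ?N + ?F1 + ?F2") for s k u
  proof (cases "\<bar>w * s - t k\<bar> \<le> R")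
    case True
    have "?L \<le> ?N"
    proof (cases "u \<in> {t k / w..<t (k + 1) / w}")
      case u: True
      have "t k \<le> w * u" "w * u < t (k + 1)" using u w by (auto simp: field_simps)
      then have "\<bar>w * u - w * s\<bar> \<le> R + \<Delta>" using True gap(2)[of k] by linarith
      moreover have "\<bar>w * u - w * s\<bar> = w * \<bar>u - s\<bar>"
        using w by (simp add: abs_mult flip: right_diff_distrib)
      ultimately have "\<bar>u - s\<bar> \<le> \<rho>" using w by (simp add: \<rho>_def field_simps)
      then have "near s u = ennreal \<bar>H u - H s\<bar>" by (simp add: near_def)
      have "?L \<le> ennreal B * ((ennreal (w / \<delta>) * I k u) * ennreal \<bar>H u - H s\<bar>)"
        by (intro mult_mono m_le ennreal_leI l) auto
      also have "\<dots> = ?N"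
        unfolding \<open>near s u = _\<close> times_divide_eq_right[symmetric]
        using \<open>0 \<le> B\<close> \<delta> w by (subst ennreal_mult) (auto simp: ac_simps)
      finally show ?thesis .
    qed (simp add: m_def cell_average_weight_def)
    also have "?N \<le> ?N + (?F1 + ?F2)" by simp
    finally show ?thesis by (simp add: add.assoc)
  next
    case False
    then have "far (w * s - t k) = ennreal (l (w * s - t k))" by (simp add: far_def)
    have "?L \<le> ennreal (l (w * s - t k)) * (m k u * (ennreal \<bar>H u\<bar> + ennreal \<bar>H s\<bar>))"
      by (intro mult_left_mono) (auto simp flip: ennreal_plus)
    also have "\<dots> = ?F1 + ?F2"
      unfolding \<open>far (w * s - t k) = _\<close> by (simp add: distrib_left)
    also have "\<dots> \<le> ?N + (?F1 + ?F2)" by simp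
    finally show ?thesis by (simp add: add.assoc)
  qed
  let ?H = "\<integral>\<^sup>+ s. ennreal \<bar>H s\<bar> \<partial>lborel"
  let ?c = "count_space (UNIV :: int set)"
  define N where "N k = (\<integral>\<^sup>+ s. \<integral>\<^sup>+ u. ennreal (B * w / \<delta>) * (I k u * near s u) \<partial>lborel \<partial>lborel)" for k
  define F1 where "F1 k = (\<integral>\<^sup>+ s. \<integral>\<^sup>+ u. far (w * s - t k) * (m k u * ennreal \<bar>H u\<bar>) \<partial>lborel \<partial>lborel)" for k
  define F2 where "F2 k = (\<integral>\<^sup>+ s. \<integral>\<^sup>+ u. far (w * s - t k) * (m k u * ennreal \<bar>H s\<bar>) \<partial>lborel \<partial>lborel)" for k

  have "oscillation t l H w = (\<integral>\<^sup>+ k. \<integral>\<^sup>+ s. ennreal (l (w * s - t k)) *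
      (\<integral>\<^sup>+ u. m k u * ennreal \<bar>H u - H s\<bar> \<partial>lborel) \<partial>lborel \<partial>?c)"
    unfolding oscillation_def m_def[symmetric] by (rule nn_integral_count_space_nn_integral) auto
  also have "\<dots> \<le> (\<integral>\<^sup>+ k. N k + F1 k + F2 k \<partial>?c)"
  proof (rule nn_integral_mono)
    fix k
    have "(\<integral>\<^sup>+ s. ennreal (l (w * s - t k)) * (\<integral>\<^sup>+ u. m k u * ennreal \<bar>H u - H s\<bar> \<partial>lborel) \<partial>lborel)
        = (\<integral>\<^sup>+ s. \<integral>\<^sup>+ u. ennreal (l (w * s - t k)) * (m k u * ennreal \<bar>H u - H s\<bar>) \<partial>lborel \<partial>lborel)"
      by (intro nn_integral_cong nn_integral_cmult[symmetric]) auto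
    also have "\<dots> \<le> (\<integral>\<^sup>+ s. \<integral>\<^sup>+ u. ennreal (B * w / \<delta>) * (I k u * near s u)
        + far (w * s - t k) * (m k u * ennreal \<bar>H u\<bar>)
        + far (w * s - t k) * (m k u * ennreal \<bar>H s\<bar>) \<partial>lborel \<partial>lborel)"
      by (intro nn_integral_mono pw)
    also have "\<dots> = N k + F1 k + F2 k"
      unfolding N_def F1_def F2_def by (simp add: nn_integral_add)
    finally show "(\<integral>\<^sup>+ s. ennreal (l (w * s - t k)) * (\<integral>\<^sup>+ u. m k u * ennreal \<bar>H u - H s\<bar> \<partial>lborel) \<partial>lborel)
        \<le> N k + F1 k + F2 k" .
  qed
  also have "\<dots> = (\<integral>\<^sup>+ k. N k \<partial>?c) + (\<integral>\<^sup>+ k. F1 k \<partial>?c) + (\<integral>\<^sup>+ k. F2 k \<partial>?c)"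
    by (simp add: nn_integral_add)
  also have "\<dots> \<le> ennreal (2 * B * (R + \<Delta>) / \<delta> * e)
     + ennreal (1 / \<delta>) * (\<integral>\<^sup>+ v. far v \<partial>lborel) * ?H + ennreal (M * R powr - \<beta>) * ?H"
  proof (intro add_mono)
    \<comment> \<open>The sum over \<open>k\<close> is moved inside, where disjointness of the cells
      removes it. The substitution \<open>u = s + h\<close> then exposes a translation by
      \<open>h\<close>, and the length \<open>2 * \<rho>\<close> of the range of \<open>h\<close>
      cancels the factor \<open>w\<close>.\<close>
    have "(\<integral>\<^sup>+ k. N k \<partial>?c)
        = (\<integral>\<^sup>+ s. \<integral>\<^sup>+ k. \<integral>\<^sup>+ u. ennreal (B * w / \<delta>) * (I k u * near s u) \<partial>lborel \<partial>?c \<partial>lborel)"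
      unfolding N_def by (rule nn_integral_count_space_nn_integral[symmetric]) auto
    also have "\<dots> = (\<integral>\<^sup>+ s. \<integral>\<^sup>+ u. \<integral>\<^sup>+ k. ennreal (B * w / \<delta>) * (I k u * near s u) \<partial>?c \<partial>lborel \<partial>lborel)"
      by (intro nn_integral_cong nn_integral_count_space_nn_integral[symmetric]) auto
    also have "\<dots> \<le> (\<integral>\<^sup>+ s. \<integral>\<^sup>+ u. ennreal (B * w / \<delta>) * near s u \<partial>lborel \<partial>lborel)"
    proof (intro nn_integral_mono)
      fix s u
      have "(\<integral>\<^sup>+ k. ennreal (B * w / \<delta>) * (I k u * near s u) \<partial>?c)
          = ennreal (B * w / \<delta>) * ((\<integral>\<^sup>+ k. I k u \<partial>?c) * near s u)"
        by (simp add: nn_integral_cmult nn_integral_multc)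
      also have "\<dots> \<le> ennreal (B * w / \<delta>) * (1 * near s u)"
        by (intro mult_left_mono mult_right_mono sumI) auto
      finally show "(\<integral>\<^sup>+ k. ennreal (B * w / \<delta>) * (I k u * near s u) \<partial>?c) \<le> ennreal (B * w / \<delta>) * near s u"
        by simp
    qed
    also have "\<dots> = ennreal (B * w / \<delta>) * (\<integral>\<^sup>+ s. \<integral>\<^sup>+ u. near s u \<partial>lborel \<partial>lborel)"
      by (simp add: nn_integral_cmult)
    also have "(\<integral>\<^sup>+ s. \<integral>\<^sup>+ u. near s u \<partial>lborel \<partial>lborel)
        = (\<integral>\<^sup>+ s. \<integral>\<^sup>+ h. indicator {- \<rho>..\<rho>} h * ennreal \<bar>H (s + h) - H s\<bar> \<partial>lborel \<partial>lborel)"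
    proof (rule nn_integral_cong)
      fix s
      have "(\<integral>\<^sup>+ u. near s u \<partial>lborel) = (\<integral>\<^sup>+ h. near s (s + h) \<partial>lborel)"
        using nn_integral_real_affine[of "near s" 1 s] by simp
      also have "\<dots> = (\<integral>\<^sup>+ h. indicator {- \<rho>..\<rho>} h * ennreal \<bar>H (s + h) - H s\<bar> \<partial>lborel)"
        by (intro nn_integral_cong) (auto simp: near_def indicator_def)
      finally show "(\<integral>\<^sup>+ u. near s u \<partial>lborel)
          = (\<integral>\<^sup>+ h. indicator {- \<rho>..\<rho>} h * ennreal \<bar>H (s + h) - H s\<bar> \<partial>lborel)" .
    qed
    also have "\<dots> = (\<integral>\<^sup>+ h. \<integral>\<^sup>+ s. indicator {- \<rho>..\<rho>} h * ennreal \<bar>H (s + h) - H s\<bar> \<partial>lborel \<partial>lborel)"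
      by (rule lborel_pair.Fubini') measurable
    also have "\<dots> \<le> (\<integral>\<^sup>+ h. ennreal e * indicator {- \<rho>..\<rho>} h \<partial>lborel)"
    proof (rule nn_integral_mono)
      fix h
      have "(\<integral>\<^sup>+ s. indicator {- \<rho>..\<rho>} h * ennreal \<bar>H (s + h) - H s\<bar> \<partial>lborel)
          = indicator {- \<rho>..\<rho>} h * (\<integral>\<^sup>+ s. ennreal \<bar>H (s + h) - H s\<bar> \<partial>lborel)"
        by (simp add: nn_integral_cmult)
      also have "\<dots> \<le> indicator {- \<rho>..\<rho>} h * ennreal e"
        using d[of h] wd by (cases "h \<in> {- \<rho>..\<rho>}") (auto simp: \<rho>_def)
      finally show "(\<integral>\<^sup>+ s. indicator {- \<rho>..\<rho>} h * ennreal \<bar>H (s + h) - H s\<bar> \<partial>lborel)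
          \<le> ennreal e * indicator {- \<rho>..\<rho>} h" by (simp add: mult.commute)
    qed
    also have "\<dots> = ennreal (e * (2 * \<rho>))"
      using \<open>0 < \<rho>\<close> e by (simp add: nn_integral_cmult ennreal_mult)
    finally have "(\<integral>\<^sup>+ k. N k \<partial>?c) \<le> ennreal (B * w / \<delta>) * ennreal (e * (2 * \<rho>))"
      by (simp add: mult_left_mono)
    also have "\<dots> = ennreal (B * w / \<delta> * (e * (2 * \<rho>)))"
      using \<open>0 \<le> B\<close> w \<delta> e \<open>0 < \<rho>\<close> by (intro ennreal_mult[symmetric]) auto
    also have "B * w / \<delta> * (e * (2 * \<rho>)) = 2 * B * (R + \<Delta>) / \<delta> * e"
      using w \<delta> by (simp add: \<rho>_def field_simps)
    finally show "(\<integral>\<^sup>+ k. N k \<partial>?c) \<le> ennreal (2 * B * (R + \<Delta>) / \<delta> * e)" .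
  next
    \<comment> \<open>Rescaling \<open>s\<close> gives a factor \<open>1 / w\<close>, which cancels
      the \<open>w / \<delta>\<close> bounding the density of a cell mean.\<close>
    have F1: "F1 k \<le> ennreal (1 / \<delta>) * (\<integral>\<^sup>+ v. far v \<partial>lborel) * (\<integral>\<^sup>+ u. I k u * ennreal \<bar>H u\<bar> \<partial>lborel)" for k
    proof -
      have "(\<integral>\<^sup>+ v. far v \<partial>lborel) = ennreal w * (\<integral>\<^sup>+ s. far (w * s - t k) \<partial>lborel)"
        using nn_integral_real_affine[of far w "- t k"] w by simp
      then have "ennreal (1 / w) * (\<integral>\<^sup>+ v. far v \<partial>lborel) = (\<integral>\<^sup>+ s. far (w * s - t k) \<partial>lborel)"
        using w by (simp add: mult.assoc[symmetric] flip: ennreal_mult)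
      moreover have "F1 k = (\<integral>\<^sup>+ s. far (w * s - t k) \<partial>lborel) * (\<integral>\<^sup>+ u. m k u * ennreal \<bar>H u\<bar> \<partial>lborel)"
        unfolding F1_def by (simp add: nn_integral_cmult nn_integral_multc)
      moreover have "(\<integral>\<^sup>+ u. m k u * ennreal \<bar>H u\<bar> \<partial>lborel)
          \<le> (\<integral>\<^sup>+ u. ennreal (w / \<delta>) * (I k u * ennreal \<bar>H u\<bar>) \<partial>lborel)"
        using m_le by (intro nn_integral_mono) (simp add: mult.assoc[symmetric] mult_right_mono)
      moreover have "\<dots> = ennreal (w / \<delta>) * (\<integral>\<^sup>+ u. I k u * ennreal \<bar>H u\<bar> \<partial>lborel)"
        by (simp add: nn_integral_cmult)
      ultimately have "F1 k \<le> (ennreal (1 / w) * (\<integral>\<^sup>+ v. far v \<partial>lborel)) *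
          (ennreal (w / \<delta>) * (\<integral>\<^sup>+ u. I k u * ennreal \<bar>H u\<bar> \<partial>lborel))"
        by (simp add: mult_left_mono)
      also have "\<dots> = (ennreal (1 / w) * ennreal (w / \<delta>)) * (\<integral>\<^sup>+ v. far v \<partial>lborel) *
          (\<integral>\<^sup>+ u. I k u * ennreal \<bar>H u\<bar> \<partial>lborel)"
        by (simp only: ac_simps)
      also have "ennreal (1 / w) * ennreal (w / \<delta>) = ennreal (1 / \<delta>)"
        using w \<delta> by (simp flip: ennreal_mult)
      finally show ?thesis .
    qed
    have "(\<integral>\<^sup>+ k. F1 k \<partial>?c) \<le> (\<integral>\<^sup>+ k. ennreal (1 / \<delta>) * (\<integral>\<^sup>+ v. far v \<partial>lborel) *
        (\<integral>\<^sup>+ u. I k u * ennreal \<bar>H u\<bar> \<partial>lborel) \<partial>?c)"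
      by (intro nn_integral_mono F1)
    also have "\<dots> = ennreal (1 / \<delta>) * (\<integral>\<^sup>+ v. far v \<partial>lborel) *
        (\<integral>\<^sup>+ k. \<integral>\<^sup>+ u. I k u * ennreal \<bar>H u\<bar> \<partial>lborel \<partial>?c)"
      by (simp add: nn_integral_cmult)
    also have "(\<integral>\<^sup>+ k. \<integral>\<^sup>+ u. I k u * ennreal \<bar>H u\<bar> \<partial>lborel \<partial>?c)
        = (\<integral>\<^sup>+ u. \<integral>\<^sup>+ k. I k u * ennreal \<bar>H u\<bar> \<partial>?c \<partial>lborel)"
      by (rule nn_integral_count_space_nn_integral[symmetric]) auto
    also have "\<dots> \<le> ?H"
    proof (rule nn_integral_mono)
      fix u
      have "(\<integral>\<^sup>+ k. I k u * ennreal \<bar>H u\<bar> \<partial>?c) = (\<integral>\<^sup>+ k. I k u \<partial>?c) * ennreal \<bar>H u\<bar>"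
        by (simp add: nn_integral_multc)
      also have "\<dots> \<le> 1 * ennreal \<bar>H u\<bar>" by (intro mult_right_mono sumI) auto
      finally show "(\<integral>\<^sup>+ k. I k u * ennreal \<bar>H u\<bar> \<partial>?c) \<le> ennreal \<bar>H u\<bar>" by simp
    qed
    finally show "(\<integral>\<^sup>+ k. F1 k \<partial>?c) \<le> ennreal (1 / \<delta>) * (\<integral>\<^sup>+ v. far v \<partial>lborel) * ?H"
      by (simp add: mult_left_mono)
  next
    \<comment> \<open>\<open>H s\<close> does not depend on \<open>u\<close>, so the cell weight
      integrates to 1 and only the far part of the envelope remains.\<close>
    have "F2 k = (\<integral>\<^sup>+ s. far (w * s - t k) * ennreal \<bar>H s\<bar> \<partial>lborel)" for k
      unfolding F2_def by (simp add: nn_integral_cmult nn_integral_multc m_int)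
    then have "(\<integral>\<^sup>+ k. F2 k \<partial>?c) = (\<integral>\<^sup>+ k. \<integral>\<^sup>+ s. far (w * s - t k) * ennreal \<bar>H s\<bar> \<partial>lborel \<partial>?c)"
      by simp
    also have "\<dots> = (\<integral>\<^sup>+ s. \<integral>\<^sup>+ k. far (w * s - t k) * ennreal \<bar>H s\<bar> \<partial>?c \<partial>lborel)"
      by (rule nn_integral_count_space_nn_integral[symmetric]) auto
    also have "\<dots> \<le> (\<integral>\<^sup>+ s. ennreal (M * R powr - \<beta>) * ennreal \<bar>H s\<bar> \<partial>lborel)"
    proof (rule nn_integral_mono)
      fix s
      have "(\<integral>\<^sup>+ k. far (w * s - t k) \<partial>?c) \<le> ennreal (M * R powr - \<beta>)"
      proof (rule nn_integral_count_space_int_le)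
        fix F :: "int set" assume "finite F"
        have "(\<Sum>k\<in>F. far (w * s - t k)) = ennreal (\<Sum>k\<in>F. l (w * s - t k) * indicator {v. R < \<bar>v\<bar>} (w * s - t k))"
          unfolding far_def using l(1) by (subst sum_ennreal[symmetric]) (auto simp: ennreal_mult' ennreal_indicator)
        also have "\<dots> \<le> ennreal (M * R powr - \<beta>)"
          by (intro ennreal_leI sum_envelope_far_le) fact+
        finally show "(\<Sum>k\<in>F. far (w * s - t k)) \<le> ennreal (M * R powr - \<beta>)" .
      qed
      then show "(\<integral>\<^sup>+ k. far (w * s - t k) * ennreal \<bar>H s\<bar> \<partial>?c)
          \<le> ennreal (M * R powr - \<beta>) * ennreal \<bar>H s\<bar>"
        by (simp add: nn_integral_multc mult_right_mono)
    qed
    also have "\<dots> = ennreal (M * R powr - \<beta>) * ?H" by (simp add: nn_integral_cmult)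
    finally show "(\<integral>\<^sup>+ k. F2 k \<partial>?c) \<le> ennreal (M * R powr - \<beta>) * ?H" .
  qed
  finally show ?thesis unfolding far_def .
qed

text \<open>The order of choices matters: first a radius \<open>n\<close> making both far terms
  small uniformly in \<open>w\<close>, then a shift bound \<open>d\<close> for the near term with
  this radius, and finally \<open>w\<close> so large that \<open>(n + \<Delta>) / w\<close> is below
  \<open>d\<close>.\<close>

lemma oscillation_tendsto_0: "(oscillation t l H \<longlongrightarrow> 0) at_top"
proof -
  have [measurable]: "H \<in> borel_measurable borel" "l \<in> borel_measurable borel"
    using H lint by auto
  have "0 \<le> B" using l(1)[of 0] l(2)[of 0] by linarith
  have "0 < \<Delta>" using gap(1,2)[of 0] \<delta> by linarith
  define h where "h = (\<integral> s. \<bar>H s\<bar> \<partial>lborel)"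
  have h0: "0 \<le> h" unfolding h_def by simp
  have h: "(\<integral>\<^sup>+ s. ennreal \<bar>H s\<bar> \<partial>lborel) = ennreal h"
    unfolding h_def using H by (intro nn_integral_eq_integral) auto
  define \<tau> where "\<tau> n = (\<integral>\<^sup>+ v. ennreal (l v) * indicator {v. real n < \<bar>v\<bar>} v \<partial>lborel)" for n
  have \<tau>: "\<tau> \<longlonglongrightarrow> 0"
  proof -
    have "(\<lambda>n. \<integral>\<^sup>+ v. ennreal (l v) * indicator {v. real n < \<bar>v\<bar>} v \<partial>lborel) \<longlonglongrightarrow> (\<integral>\<^sup>+ v. 0 \<partial>(lborel :: real measure))"
    proof (rule nn_integral_dominated_convergence[where w="\<lambda>v. ennreal (l v)"])
      show "(\<integral>\<^sup>+ v. ennreal (l v) \<partial>lborel) < \<infinity>"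
        using lint l(1) by (simp add: integrable_iff_bounded)
      have "(\<lambda>n. ennreal (l v) * indicator {v. real n < \<bar>v\<bar>} v) \<longlonglongrightarrow> 0" for v
      proof (rule tendsto_eventually)
        show "\<forall>\<^sub>F n in sequentially. ennreal (l v) * indicator {v. real n < \<bar>v\<bar>} v = 0"
          using eventually_ge_at_top[of "nat \<lceil>\<bar>v\<bar>\<rceil>"]
        proof eventually_elim
          case (elim n)
          then have "\<bar>v\<bar> \<le> real n" by linarith
          then show ?case by simp
        qed
      qed
      then show "AE v in lborel. (\<lambda>n. ennreal (l v) * indicator {v. real n < \<bar>v\<bar>} v) \<longlonglongrightarrow> 0" by simp
    qed (auto simp: indicator_def)
    then show ?thesis by (simp add: \<tau>_def[abs_def])
  qed
  have M: "(\<lambda>n. M * real n powr - \<beta>) \<longlonglongrightarrow> 0"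
    using \<beta> by (intro tendsto_mult_right_zero tendsto_neg_powr filterlim_real_sequentially) auto
  have small: "\<forall>\<^sub>F w in at_top. oscillation t l H w \<le> ennreal \<epsilon>" if \<epsilon>: "0 < \<epsilon>" for \<epsilon>
  proof -
    \<comment> \<open>Dividing by \<open>h + 1\<close> instead of \<open>h\<close> covers the case
      that the norm of \<open>H\<close> vanishes.\<close>
    have "\<forall>\<^sub>F n in sequentially. \<tau> n < ennreal (\<epsilon> / 3 * \<delta> / (h + 1))"
      using \<tau> \<epsilon> \<delta> h0 by (intro order_tendstoD) auto
    moreover have "\<forall>\<^sub>F n in sequentially. M * real n powr - \<beta> < \<epsilon> / 3 / (h + 1)"
      using M \<epsilon> h0 by (intro order_tendstoD) auto
    moreover have "\<forall>\<^sub>F n in sequentially. (0::nat) < n" by (rule eventually_gt_at_top)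
    ultimately have "\<forall>\<^sub>F n in sequentially. \<tau> n < ennreal (\<epsilon> / 3 * \<delta> / (h + 1))
        \<and> M * real n powr - \<beta> < \<epsilon> / 3 / (h + 1) \<and> 0 < n" by eventually_elim simp
    then obtain n where n: "\<tau> n < ennreal (\<epsilon> / 3 * \<delta> / (h + 1))"
        "M * real n powr - \<beta> < \<epsilon> / 3 / (h + 1)" "0 < n"
      by (auto simp: eventually_sequentially)
    \<comment> \<open>Solves for a near term of at most \<open>\<epsilon> / 3\<close>; the added 1
      keeps the denominator positive when \<open>B\<close> is 0.\<close>
    define e where "e = \<epsilon> / 3 * \<delta> / (2 * B * (real n + \<Delta>) + 1)"
    have K: "0 \<le> 2 * B * (real n + \<Delta>)" using \<open>0 \<le> B\<close> \<open>0 < \<Delta>\<close> by simp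
    then have e: "0 < e" using \<epsilon> \<delta> by (simp add: e_def)
    obtain d where d: "0 < d" "\<And>h. \<bar>h\<bar> < d \<Longrightarrow> (\<integral>\<^sup>+ s. ennreal \<bar>H (s + h) - H s\<bar> \<partial>lborel) \<le> ennreal e"
      using L1_translation[OF H e] by auto
    have frac: "x / (x + 1) \<le> 1" if "0 \<le> x" for x :: real using that by simp
    have T1: "ennreal (2 * B * (real n + \<Delta>) / \<delta> * e) \<le> ennreal (\<epsilon> / 3)"
    proof (rule ennreal_leI)
      have "2 * B * (real n + \<Delta>) / \<delta> * e
          = \<epsilon> / 3 * ((2 * B * (real n + \<Delta>)) / (2 * B * (real n + \<Delta>) + 1))"
        using \<delta> by (simp add: e_def)
      also have "\<dots> \<le> \<epsilon> / 3 * 1" using \<epsilon> by (intro mult_left_mono frac K) auto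
      finally show "2 * B * (real n + \<Delta>) / \<delta> * e \<le> \<epsilon> / 3" by simp
    qed
    have T2: "ennreal (1 / \<delta>) * \<tau> n * ennreal h \<le> ennreal (\<epsilon> / 3)"
    proof -
      have "ennreal (1 / \<delta>) * \<tau> n * ennreal h \<le> ennreal (1 / \<delta>) * ennreal (\<epsilon> / 3 * \<delta> / (h + 1)) * ennreal h"
        using n(1) by (intro mult_right_mono mult_left_mono) auto
      also have "\<dots> = ennreal (1 / \<delta> * (\<epsilon> / 3 * \<delta> / (h + 1)) * h)"
      proof -
        have "0 \<le> \<epsilon> / 3 * \<delta> / (h + 1)" using \<delta> \<epsilon> h0 by simp
        then show ?thesis by (simp only: ennreal_mult''[OF h0] ennreal_mult'')
      qed
      also have "1 / \<delta> * (\<epsilon> / 3 * \<delta> / (h + 1)) * h = \<epsilon> / 3 * (h / (h + 1))"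
        using \<delta> by simp
      also have "ennreal \<dots> \<le> ennreal (\<epsilon> / 3 * 1)"
        using \<epsilon> h0 by (intro ennreal_leI mult_left_mono frac) auto
      finally show ?thesis by simp
    qed
    have T3: "ennreal (M * real n powr - \<beta>) * ennreal h \<le> ennreal (\<epsilon> / 3)"
    proof -
      have "ennreal (M * real n powr - \<beta>) * ennreal h \<le> ennreal (\<epsilon> / 3 / (h + 1)) * ennreal h"
        using n(2) by (intro mult_right_mono ennreal_leI) auto
      also have "\<dots> = ennreal (\<epsilon> / 3 * (h / (h + 1)))"
        using \<epsilon> h0 by (simp flip: ennreal_mult)
      also have "\<dots> \<le> ennreal (\<epsilon> / 3 * 1)"
        using \<epsilon> h0 by (intro ennreal_leI mult_left_mono frac) auto
      finally show ?thesis by simp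
    qed
    show ?thesis
      using eventually_gt_at_top[of "max 0 ((real n + \<Delta>) / d)"]
    proof eventually_elim
      case (elim w)
      then have w: "0 < w" "(real n + \<Delta>) / w < d" using d(1) by (auto simp: field_simps)
      have "oscillation t l H w \<le> ennreal (2 * B * (real n + \<Delta>) / \<delta> * e)
          + ennreal (1 / \<delta>) * \<tau> n * ennreal h + ennreal (M * real n powr - \<beta>) * ennreal h"
        using oscillation_le[OF w(1) _ d(2) _ w(2)] n(3) e by (simp add: h \<tau>_def)
      also have "\<dots> \<le> ennreal (\<epsilon> / 3) + ennreal (\<epsilon> / 3) + ennreal (\<epsilon> / 3)"
        by (intro add_mono T1 T2 T3)
      also have "\<dots> = ennreal \<epsilon>" using \<epsilon> by (simp flip: ennreal_plus)
      finally show ?case .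
    qed
  qed
  show ?thesis
  proof (rule order_tendstoI)
    fix a :: ennreal assume "0 < a"
    then obtain r where r: "0 < r" "r < a" using dense by blast
    then obtain x where x: "r = ennreal x" "0 \<le> x" by (cases r) (auto simp: top_unique)
    then have "0 < x" using r by (simp add: less_le)
    from small[OF this] show "\<forall>\<^sub>F w in at_top. oscillation t l H w < a"
      by eventually_elim (use r x in auto)
  qed simp
qed

end

end

end

section \<open>Sampling series and the kernel error at a fixed value\<close>

lemma borel_measurable_count_space_int [measurable]:
  fixes f :: "int \<Rightarrow> 'a \<Rightarrow> ennreal"
  assumes [measurable]: "\<And>k. f k \<in> borel_measurable M"
  shows "(\<lambda>x. \<integral>\<^sup>+ k. f k x \<partial>count_space UNIV) \<in> borel_measurable M"
proof -
  have "(\<integral>\<^sup>+ k. f k x \<partial>count_space UNIV) = (\<Sum>n. f (int_decode n) x)" for x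
    using nn_integral_bij_count_space[OF bij_int_decode, of "\<lambda>k. f k x"]
    by (simp add: nn_integral_count_space_nat)
  then show ?thesis by simp
qed

text \<open>Dividing the weights by \<open>A\<close> makes their mass at most 1, so Jensen's
  inequality applies to finite sums; the compensating factor \<open>A\<close> is absorbed by
  \<open>c * A \<le> C\<close>. Since \<open>\<phi>\<close> tends to infinity, a bound for its
  values bounds the absolute partial sums, which gives convergence. Continuity of
  \<open>\<phi>\<close> carries the estimate to the limit.\<close>

lemma phi_sum_le:
  fixes l d z :: "int \<Rightarrow> real"
  assumes \<phi>: "phi_function \<phi>" "convex_on {0..} \<phi>" and \<eta>0: "\<And>u. 0 \<le> u \<Longrightarrow> 0 \<le> \<eta> u"
    and C: "\<And>u. 0 \<le> u \<Longrightarrow> \<phi> (C * \<psi> u) \<le> \<eta> (a * u)" and \<psi>0: "\<And>u. 0 \<le> u \<Longrightarrow> 0 \<le> \<psi> u"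
    and a: "0 \<le> a"
    and l0: "\<And>k. 0 \<le> l k" and A: "1 \<le> A" "\<And>F. finite F \<Longrightarrow> sum l F \<le> A"
    and c: "0 < c" "c * A \<le> C" and d0: "\<And>k. 0 \<le> d k" and z: "\<And>k. \<bar>z k\<bar> \<le> l k * \<psi> (d k)"
    and fin: "(\<integral>\<^sup>+ k. ennreal (l k) * ennreal (\<eta> (a * d k)) \<partial>count_space UNIV) < \<infinity>"
  shows "z summable_on UNIV"
    and "ennreal (\<phi> (c * \<bar>infsum z UNIV\<bar>))
      \<le> (\<integral>\<^sup>+ k. ennreal (l k) * ennreal (\<eta> (a * d k)) \<partial>count_space UNIV)"
proof -
  note phi = phi_functionD[OF \<phi>(1)]
  obtain b where b: "(\<integral>\<^sup>+ k. ennreal (l k) * ennreal (\<eta> (a * d k)) \<partial>count_space UNIV) = ennreal b" "0 \<le> b"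
    using fin by (cases "\<integral>\<^sup>+ k. ennreal (l k) * ennreal (\<eta> (a * d k)) \<partial>count_space UNIV") auto
  have part: "\<phi> (c * (\<Sum>k\<in>F. l k * \<psi> (d k))) \<le> b" if F: "finite F" for F
  proof -
    have "c * (\<Sum>k\<in>F. l k * \<psi> (d k)) = (\<Sum>k\<in>F. (l k / A) * (c * A * \<psi> (d k)))"
      unfolding sum_distrib_left using A(1) by (intro sum.cong) auto
    also have "\<phi> \<dots> \<le> (\<Sum>k\<in>F. (l k / A) * \<phi> (c * A * \<psi> (d k)))"
    proof (rule convex_sum_le[OF \<phi>(2) phi(1) F])
      show "(\<Sum>k\<in>F. l k / A) \<le> 1"
        using A(2)[OF F] A(1) by (simp flip: sum_divide_distrib)
    qed (use l0 A(1) c(1) \<psi>0 d0 in auto)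
    also have "\<dots> \<le> (\<Sum>k\<in>F. l k * \<eta> (a * d k))"
    proof (rule sum_mono)
      fix k
      have "\<phi> (c * A * \<psi> (d k)) \<le> \<phi> (C * \<psi> (d k))"
        using c A(1) \<psi>0[OF d0, of k] by (intro phi(2) mult_right_mono) auto
      also have "\<dots> \<le> \<eta> (a * d k)" by (rule C[OF d0])
      finally have *: "\<phi> (c * A * \<psi> (d k)) \<le> \<eta> (a * d k)" .
      \<comment> \<open>The leftover factor \<open>1 / A\<close> is discarded, which uses
        \<open>1 \<le> A\<close>.\<close>
      have "l k / A \<le> l k" using l0[of k] A(1) by (simp add: divide_le_eq mult_le_cancel_left1)
      moreover have "0 \<le> \<phi> (c * A * \<psi> (d k))"
        using c A(1) \<psi>0[OF d0, of k] by (intro phi(3)) auto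
      ultimately show "l k / A * \<phi> (c * A * \<psi> (d k)) \<le> l k * \<eta> (a * d k)"
        using * l0[of k] by (intro mult_mono) auto
    qed
    finally have "ennreal (\<phi> (c * (\<Sum>k\<in>F. l k * \<psi> (d k)))) \<le> ennreal (\<Sum>k\<in>F. l k * \<eta> (a * d k))"
      by (rule ennreal_leI)
    also have "\<dots> = (\<Sum>k\<in>F. ennreal (l k) * ennreal (\<eta> (a * d k)))"
      using l0 \<eta>0 a d0 by (subst sum_ennreal[symmetric]) (auto simp: ennreal_mult)
    also have "\<dots> \<le> ennreal b"
      unfolding b(1)[symmetric] by (rule sum_le_nn_integral_count_space[OF F])
    finally show ?thesis using b(2) by (simp add: ennreal_le_iff)
  qed
  have abs_le: "(\<Sum>k\<in>F. \<bar>z k\<bar>) \<le> (\<Sum>k\<in>F. l k * \<psi> (d k))" for F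
    by (rule sum_mono) (rule z)
  have part': "\<phi> (c * \<bar>sum z F\<bar>) \<le> b" if F: "finite F" for F
  proof -
    have "\<bar>sum z F\<bar> \<le> (\<Sum>k\<in>F. l k * \<psi> (d k))" using sum_abs[of z F] abs_le[of F] by linarith
    then have "\<phi> (c * \<bar>sum z F\<bar>) \<le> \<phi> (c * (\<Sum>k\<in>F. l k * \<psi> (d k)))"
      using c(1) by (intro phi(2) mult_left_mono) auto
    then show ?thesis using part[OF F] by linarith
  qed
  have "filterlim \<phi> at_top at_top" using \<phi>(1) by (simp add: phi_function_def)
  then have "\<forall>\<^sub>F u in at_top. b < \<phi> u" by (simp add: filterlim_at_top_dense)
  \<comment> \<open>Beyond \<open>U\<close> the values of \<open>\<phi>\<close> exceed
    \<open>b\<close>, so every \<open>c\<close>-multiple of a partial sum stays below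
    \<open>U\<close>.\<close>
  then obtain U where U: "\<And>u. U \<le> u \<Longrightarrow> b < \<phi> u" unfolding eventually_at_top_linorder by blast
  have "(\<lambda>k. \<bar>z k\<bar>) summable_on UNIV"
  proof (rule nonneg_bdd_above_summable_on)
    show "bdd_above (sum (\<lambda>k. \<bar>z k\<bar>) ` {F. F \<subseteq> UNIV \<and> finite F})"
    proof (rule bdd_aboveI2)
      fix F :: "int set" assume "F \<in> {F. F \<subseteq> UNIV \<and> finite F}"
      then have "finite F" by simp
      from part[OF this] have "c * (\<Sum>k\<in>F. l k * \<psi> (d k)) < U"
        using U[of "c * (\<Sum>k\<in>F. l k * \<psi> (d k))"] by linarith
      then have "(\<Sum>k\<in>F. l k * \<psi> (d k)) \<le> U / c" using c(1) by (simp add: field_simps)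
      then show "(\<Sum>k\<in>F. \<bar>z k\<bar>) \<le> U / c" using abs_le[of F] by linarith
    qed
  qed simp
  then show sm: "z summable_on UNIV"
    using abs_summable_summable[of z UNIV] by simp
  have "(sum z \<longlongrightarrow> infsum z UNIV) (finite_subsets_at_top UNIV)"
    using sm by (rule infsum_tendsto)
  then have "((\<lambda>F. c * sum z F) \<longlongrightarrow> c * infsum z UNIV) (finite_subsets_at_top UNIV)"
    by (intro tendsto_intros)
  moreover have "isCont (\<lambda>x. \<phi> \<bar>x\<bar>) (c * infsum z UNIV)"
    using continuous_on_phi_abs[OF \<phi>(1)] by (simp add: continuous_on_eq_continuous_at)
  ultimately have "((\<lambda>F. \<phi> \<bar>c * sum z F\<bar>) \<longlongrightarrow> \<phi> \<bar>c * infsum z UNIV\<bar>) (finite_subsets_at_top UNIV)"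
    using isCont_tendsto_compose by blast
  then have "\<phi> \<bar>c * infsum z UNIV\<bar> \<le> b"
  proof (rule tendsto_upperbound)
    show "\<forall>\<^sub>F F in finite_subsets_at_top UNIV. \<phi> \<bar>c * sum z F\<bar> \<le> b"
      using c(1) part' by (intro eventually_finite_subsets_at_top_weakI) (simp add: abs_mult)
  qed simp
  then show "ennreal (\<phi> (c * \<bar>infsum z UNIV\<bar>))
      \<le> (\<integral>\<^sup>+ k. ennreal (l k) * ennreal (\<eta> (a * d k)) \<partial>count_space UNIV)"
    unfolding b(1) using c(1) by (intro ennreal_leI) (simp add: abs_mult)
qed

text \<open>With \<open>j = 1\<close> the two suprema cover \<open>\<bar>u\<bar> < 1\<close> and
  \<open>\<bar>u\<bar> \<ge> 1\<close>. The second one measures a relative error; multiplying by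
  \<open>\<bar>u\<bar>\<close> makes it absolute and accounts for the growth
  \<open>1 + \<bar>u\<bar>\<close>.\<close>

lemma uniform_kernel_error:
  assumes "uniform_bigo (S_err t \<kappa> 1) \<alpha>" "uniform_bigo (T_err t \<kappa> 1) \<alpha>"
  obtains D where "0 \<le> D" "\<forall>\<^sub>F w in at_top. \<forall>x>0. \<forall>u.
    \<bar>(\<Sum>\<^sub>\<infinity>k\<in>UNIV. \<kappa> (exp (- t k) * x powr w) u) - u\<bar> \<le> D * (1 + \<bar>u\<bar>) * w powr - \<alpha>"
proof -
  obtain C1 where C1: "\<forall>\<^sub>F w in at_top. \<forall>x>0. S_err t \<kappa> 1 w x \<le> ennreal (C1 * w powr - \<alpha>)"
    using assms(1) unfolding uniform_bigo_def by blast
  obtain C2 where C2: "\<forall>\<^sub>F w in at_top. \<forall>x>0. T_err t \<kappa> 1 w x \<le> ennreal (C2 * w powr - \<alpha>)"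
    using assms(2) unfolding uniform_bigo_def by blast
  \<comment> \<open>The constants of the asymptotic bounds may be negative, and
    \<open>ennreal\<close> sends negative numbers to 0; hence the absolute value.\<close>
  have le: "x \<le> \<bar>C\<bar> * y" if "ennreal x \<le> ennreal (C * y)" "0 \<le> y" for x y C :: real
  proof -
    have "ennreal x \<le> ennreal (\<bar>C\<bar> * y)"
      using that order_trans[OF that(1) ennreal_leI[of "C * y" "\<bar>C\<bar> * y"]] by (simp add: mult_right_mono)
    then show ?thesis using that(2) by (simp add: ennreal_le_iff)
  qed
  define D where "D = \<bar>C1\<bar> + \<bar>C2\<bar>"
  have "\<forall>\<^sub>F w in at_top. \<forall>x>0. \<forall>u.
    \<bar>(\<Sum>\<^sub>\<infinity>k\<in>UNIV. \<kappa> (exp (- t k) * x powr w) u) - u\<bar> \<le> D * (1 + \<bar>u\<bar>) * w powr - \<alpha>"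
    using C1 C2
  proof eventually_elim
    case (elim w)
    show ?case
    proof (intro allI impI)
      fix x u :: real assume x: "0 < x"
      define \<Sigma> where "\<Sigma> = (\<Sum>\<^sub>\<infinity>k\<in>UNIV. \<kappa> (exp (- t k) * x powr w) u)"
      let ?p = "w powr - \<alpha>"
      have "\<bar>\<Sigma> - u\<bar> \<le> \<bar>C1\<bar> * ?p \<or> \<bar>\<Sigma> - u\<bar> \<le> \<bar>C2\<bar> * \<bar>u\<bar> * ?p"
      proof (cases "\<bar>u\<bar> < 1")
        case True
        then have "ennreal \<bar>\<Sigma> - u\<bar> \<le> S_err t \<kappa> 1 w x"
          unfolding S_err_def \<Sigma>_def by (intro SUP_upper) auto
        then have "ennreal \<bar>\<Sigma> - u\<bar> \<le> ennreal (C1 * ?p)" using elim(1) x order_trans by blast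
        then show ?thesis using le by simp
      next
        case False
        then have u: "1 \<le> \<bar>u\<bar>" by simp
        then have "ennreal \<bar>1 / u * \<Sigma> - 1\<bar> \<le> T_err t \<kappa> 1 w x"
          unfolding T_err_def \<Sigma>_def by (intro SUP_upper) auto
        then have "ennreal \<bar>1 / u * \<Sigma> - 1\<bar> \<le> ennreal (C2 * ?p)" using elim(2) x order_trans by blast
        then have "\<bar>1 / u * \<Sigma> - 1\<bar> \<le> \<bar>C2\<bar> * ?p" using le by simp
        then have "\<bar>u\<bar> * \<bar>1 / u * \<Sigma> - 1\<bar> \<le> \<bar>u\<bar> * (\<bar>C2\<bar> * ?p)" by (rule mult_left_mono) simp
        moreover have "\<bar>u\<bar> * \<bar>1 / u * \<Sigma> - 1\<bar> = \<bar>\<Sigma> - u\<bar>"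
        proof -
          have "u * (1 / u * \<Sigma> - 1) = \<Sigma> - u" using u by (auto simp: right_diff_distrib)
          then show ?thesis by (metis abs_mult)
        qed
        ultimately show ?thesis by (simp add: ac_simps)
      qed
      moreover have "\<bar>C1\<bar> * ?p \<le> D * (1 + \<bar>u\<bar>) * ?p"
        unfolding D_def by (intro mult_right_mono) (auto simp: algebra_simps)
      moreover have "\<bar>C2\<bar> * \<bar>u\<bar> * ?p \<le> D * (1 + \<bar>u\<bar>) * ?p"
        unfolding D_def by (intro mult_right_mono) (auto simp: algebra_simps)
      ultimately show "\<bar>(\<Sum>\<^sub>\<infinity>k\<in>UNIV. \<kappa> (exp (- t k) * x powr w) u) - u\<bar> \<le> D * (1 + \<bar>u\<bar>) * ?p"
        unfolding \<Sigma>_def by linarith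
    qed
  qed
  then show ?thesis using that[of D] by (simp add: D_def)
qed

text \<open>Dominated convergence: the second argument of the minimum gives the pointwise limit 0,
  and the first gives a majorant independent of \<open>w\<close>.\<close>

lemma phi_error_tendsto_0:
  fixes g :: "real \<Rightarrow> real"
  assumes \<phi>: "phi_function \<phi>" and \<alpha>: "0 < \<alpha>" and c: "0 < c" and D: "0 \<le> D"
    and g [measurable]: "g \<in> borel_measurable borel"
    and Y: "continuous_on {0..} Y" "\<And>u. 0 \<le> u \<Longrightarrow> 0 \<le> Y u"
    and fin: "(\<integral>\<^sup>+ s. ennreal (\<phi> (c * Y \<bar>g s\<bar>)) \<partial>lborel) < \<infinity>"
  shows "((\<lambda>w. \<integral>\<^sup>+ s. ennreal (\<phi> (c * min (Y \<bar>g s\<bar>) (D * (1 + \<bar>g s\<bar>) * w powr - \<alpha>))) \<partial>lborel) \<longlongrightarrow> 0) at_top"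
proof -
  note phi = phi_functionD[OF \<phi>]
  have [measurable]: "(\<lambda>x. Y \<bar>x\<bar>) \<in> borel_measurable borel"
    by (intro borel_measurable_continuous_onI continuous_on_compose2[OF Y(1)] continuous_intros) auto
  define E where "E w s = min (Y \<bar>g s\<bar>) (D * (1 + \<bar>g s\<bar>) * w powr - \<alpha>)" for w s
  have E: "0 \<le> E w s" "E w s \<le> Y \<bar>g s\<bar>" for w s
    using D Y(2) by (auto simp: E_def)
  have [measurable]: "(\<lambda>s. E w s) \<in> borel_measurable borel" for w unfolding E_def by measurable
  have meas [measurable]: "(\<lambda>s. \<phi> (c * h s)) \<in> borel_measurable borel"
    if [measurable]: "h \<in> borel_measurable borel" and "\<And>s. 0 \<le> h s" for h :: "real \<Rightarrow> real"
  proof -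
    have "(\<lambda>s. \<phi> \<bar>c * h s\<bar>) \<in> borel_measurable borel"
      using phi_abs_measurable[OF \<phi>] by measurable
    then show ?thesis using that c by (simp add: abs_mult)
  qed
  have "((\<lambda>w. \<integral>s. \<phi> (c * E w s) \<partial>lborel) \<longlongrightarrow> (\<integral>s. 0 \<partial>(lborel :: real measure))) at_top"
  proof (rule integral_dominated_convergence_at_top[where w="\<lambda>s. \<phi> (c * Y \<bar>g s\<bar>)"])
    show "integrable lborel (\<lambda>s. \<phi> (c * Y \<bar>g s\<bar>))"
      using fin meas[of "\<lambda>s. Y \<bar>g s\<bar>"] Y(2) c phi(3) by (intro integrableI_nonneg) auto
    show "\<forall>\<^sub>F w in at_top. AE s in lborel. norm (\<phi> (c * E w s)) \<le> \<phi> (c * Y \<bar>g s\<bar>)"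
      using c E phi(2,3) by (intro always_eventually allI AE_I2) (auto simp: mult_left_mono)
    have "((\<lambda>w. \<phi> (c * E w s)) \<longlongrightarrow> 0) at_top" for s
    proof -
      have "((\<lambda>w::real. w powr - \<alpha>) \<longlongrightarrow> 0) at_top"
        using \<alpha> by (intro tendsto_neg_powr filterlim_ident) auto
      then have "((\<lambda>w. D * (1 + \<bar>g s\<bar>) * w powr - \<alpha>) \<longlongrightarrow> 0) at_top"
        by (intro tendsto_mult_right_zero)
      then have "((\<lambda>w. E w s) \<longlongrightarrow> 0) at_top"
        by (rule tendsto_sandwich[OF _ _ tendsto_const, rotated 2]) (use E(1) in \<open>auto simp: E_def\<close>)
      then have "((\<lambda>w. c * E w s) \<longlongrightarrow> 0) at_top" by (rule tendsto_mult_right_zero)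
      moreover have "isCont (\<lambda>x. \<phi> \<bar>x\<bar>) 0"
        using continuous_on_phi_abs[OF \<phi>] by (simp add: continuous_on_eq_continuous_at)
      ultimately have "((\<lambda>w. \<phi> \<bar>c * E w s\<bar>) \<longlongrightarrow> \<phi> \<bar>0\<bar>) at_top"
        using isCont_tendsto_compose by blast
      then show ?thesis using E(1) c by (simp add: abs_mult phi(1))
    qed
    then show "AE s in lborel. ((\<lambda>w. \<phi> (c * E w s)) \<longlongrightarrow> 0) at_top" by simp
  qed (use E(1) in measurable)
  then have "((\<lambda>w. ennreal (\<integral>s. \<phi> (c * E w s) \<partial>lborel)) \<longlongrightarrow> ennreal 0) at_top"
    by (intro tendsto_ennrealI) simp
  moreover have "(\<integral>\<^sup>+ s. ennreal (\<phi> (c * E w s)) \<partial>lborel) = ennreal (\<integral>s. \<phi> (c * E w s) \<partial>lborel)" for w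
  proof (rule nn_integral_eq_integral)
    show "integrable lborel (\<lambda>s. \<phi> (c * E w s))"
    proof (rule integrableI_nonneg)
      have "(\<integral>\<^sup>+ s. ennreal (\<phi> (c * E w s)) \<partial>lborel) \<le> (\<integral>\<^sup>+ s. ennreal (\<phi> (c * Y \<bar>g s\<bar>)) \<partial>lborel)"
        using c E by (intro nn_integral_mono ennreal_leI phi(2) mult_left_mono) auto
      then show "(\<integral>\<^sup>+ s. ennreal (\<phi> (c * E w s)) \<partial>lborel) < \<infinity>" using fin by order
    qed (use E(1) c phi(3) meas in auto)
  qed (use E(1) c phi(3) in auto)
  ultimately show ?thesis unfolding E_def by simp
qed

text \<open>Lebesgue measure is complete, so \<open>f\<close> inherits measurability from its Borel
  version \<open>g\<close>; for a Borel integrand the completion does not change the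
  integral.\<close>

lemma set_lebesgue_integral_AE_lborel:
  fixes f g :: "real \<Rightarrow> real"
  assumes g [measurable]: "g \<in> borel_measurable borel" and eq: "AE u in lborel. f u = g u"
  shows "(LINT u:{a..b}|lebesgue. f u) = (LINT u:{a..b}|lborel. g u)"
proof -
  have gl: "g \<in> borel_measurable lebesgue"
    using measurable_completion[of g lborel borel] by simp
  have ae: "AE u in lebesgue. g u = f u"
    by (rule AE_completion) (use eq in eventually_elim, simp)
  have fl: "f \<in> borel_measurable lebesgue"
    by (rule borel_measurable_AE[OF gl ae])
  have "(LINT u:{a..b}|lebesgue. f u) = (LINT u:{a..b}|lebesgue. g u)"
    unfolding set_lebesgue_integral_def
  proof (rule integral_cong_AE)
    show "(\<lambda>u. indicat_real {a..b} u *\<^sub>R f u) \<in> borel_measurable lebesgue"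
      "(\<lambda>u. indicat_real {a..b} u *\<^sub>R g u) \<in> borel_measurable lebesgue"
      by (intro borel_measurable_scaleR borel_measurable_indicator fl gl, simp)+
    show "AE u in lebesgue. indicat_real {a..b} u *\<^sub>R f u = indicat_real {a..b} u *\<^sub>R g u"
      using ae by eventually_elim simp
  qed
  also have "\<dots> = (LINT u:{a..b}|lborel. g u)"
    unfolding set_lebesgue_integral_def by (rule integral_completion) auto
  finally show ?thesis .
qed

section \<open>Modular convergence of the Kantorovich operators\<close>

theorem theorem13:
  fixes t :: "int \<Rightarrow> real" and L \<psi> \<phi> \<eta> f :: "real \<Rightarrow> real" and \<alpha> \<beta> :: real
    and \<kappa> :: "real \<Rightarrow> real \<Rightarrow> real"
  assumes "sampling_nodes t"
    and "nonlinear_kernel t L \<psi> \<alpha> \<beta> \<kappa>"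
    and "phi_function \<phi>" and "convex_on {0..} \<phi>"
    and "phi_function \<eta>" and "convex_on {0..} \<eta>"
    and "\<forall>a\<in>{0<..<1}. \<exists>C\<in>{0<..<1}. \<forall>u\<ge>0. \<phi> (C * \<psi> u) \<le> \<eta> (a * u)"
    and "f \<in> mellin_orlicz (\<lambda>u. \<phi> u + \<eta> u)"
  shows "\<exists>c>0. ((\<lambda>w. modular \<phi> (\<lambda>x. c * (kantorovich t \<kappa> w f x - f x))) \<longlongrightarrow> 0) at_top"
proof -
  obtain \<delta> \<Delta> where \<delta>: "0 < \<delta>"
    and gap: "\<And>k. \<delta> \<le> t (k + 1) - t k" "\<And>k. t (k + 1) - t k \<le> \<Delta>"
    using assms(1) unfolding sampling_nodes_def by blast
  have kd: "kernel_data L \<psi> \<alpha> \<beta>"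
    and \<kappa>_summable: "\<And>x u w. 0 < x \<Longrightarrow> 0 < w \<Longrightarrow> (\<lambda>k. \<bar>\<kappa> (exp (- t k) * x powr w) u\<bar>) summable_on UNIV"
    and \<kappa>_zero: "\<And>x. 0 < x \<Longrightarrow> \<kappa> x 0 = 0"
    and \<kappa>_lip: "\<And>x u v. 0 < x \<Longrightarrow> \<bar>\<kappa> x u - \<kappa> x v\<bar> \<le> L x * \<psi> \<bar>u - v\<bar>"
    and err: "uniform_bigo (S_err t \<kappa> 1) \<alpha>" "uniform_bigo (T_err t \<kappa> 1) \<alpha>"
    and L_int: "integrable haar L" and L_bdd: "bounded (L ` {0<..})" and mom: "abs_moment \<beta> t L < \<infinity>"
    using assms(2) unfolding nonlinear_kernel_def by auto
  have L_meas: "L \<in> borel_measurable haar" and L0: "\<And>x. 0 < x \<Longrightarrow> 0 \<le> L x"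
    and \<psi>0: "\<And>u. 0 \<le> u \<Longrightarrow> 0 \<le> \<psi> u" and \<psi>_cont: "continuous_on {0..} \<psi>"
    and \<alpha>: "0 < \<alpha>" and \<beta>: "0 < \<beta>"
    using kd unfolding kernel_data_def by auto
  note \<phi> = assms(3,4) and \<eta> = assms(5,6)
  note phi = phi_functionD[OF \<phi>(1)] and eta = phi_functionD[OF \<eta>(1)]

  text \<open>A Borel envelope that nowhere exceeds \<open>L\<close> keeps the bounds of \<open>L\<close> at every point.\<close>
  obtain l0 where l0 [measurable]: "l0 \<in> borel_measurable borel"
    and l0_eq: "AE s in lborel. L (exp s) = l0 s"
    using haar_borel_representative[OF L_meas] by blast
  then obtain N where N: "{s. L (exp s) \<noteq> l0 s} \<subseteq> N" and N0: "N \<in> null_sets lborel"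
    unfolding eventually_ae_filter by auto
  have [measurable]: "N \<in> sets borel" using N0 by auto
  define l where "l s = (if s \<in> N then 0 else l0 s)" for s
  have [measurable]: "l \<in> borel_measurable borel" unfolding l_def by measurable
  have l_off: "l0 s = L (exp s)" if "s \<notin> N" for s
    using N that by force
  have l_le: "l s \<le> L (exp s)" and l_ge: "0 \<le> l s" for s
    using l_off[of s] L0[of "exp s"] by (cases "s \<in> N"; simp add: l_def)+
  have l_eq: "AE s in lborel. L (exp s) = l s"
    using AE_not_in[OF N0] by eventually_elim (simp add: l_def l_off)
  obtain B where B: "\<And>s. l s \<le> B"
  proof -
    obtain B where "\<And>x. 0 < x \<Longrightarrow> \<bar>L x\<bar> \<le> B" using L_bdd by (auto simp: bounded_iff)
    from this[OF exp_gt_zero] have "l s \<le> B" for s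
      using l_le[of s] by (meson abs_le_D1 order_trans)
    then show ?thesis by (rule that)
  qed
  have l_int: "integrable lborel l"
  proof (rule integrableI_nonneg)
    have "AE x in haar. ennreal (l (ln x)) = ennreal (norm (L x))"
      unfolding AE_haar_iff using l_eq by eventually_elim (simp add: l_ge)
    then have "(\<integral>\<^sup>+ x. ennreal (l (ln x)) \<partial>haar) = (\<integral>\<^sup>+ x. ennreal (norm (L x)) \<partial>haar)"
      by (rule nn_integral_cong_AE)
    then show "(\<integral>\<^sup>+ s. ennreal (l s) \<partial>lborel) < \<infinity>"
      using L_int nn_integral_haar_ln[of "\<lambda>s. ennreal (l s)"] by (simp add: integrable_iff_bounded)
  qed (use l_ge in auto)
  \<comment> \<open>The moment is finite, so \<open>enn2real\<close> preserves its value. At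
    \<open>exp x\<close> its summands are those of \<open>L\<close> over the shifted nodes, which
    dominate the ones of \<open>l\<close>.\<close>
  define M where "M = enn2real (abs_moment \<beta> t L)"
  have M: "(\<Sum>k\<in>F. l (x - t k) * \<bar>x - t k\<bar> powr \<beta>) \<le> M" if "finite F" for x F
  proof -
    have "ennreal (\<Sum>k\<in>F. l (x - t k) * \<bar>x - t k\<bar> powr \<beta>)
        = (\<Sum>k\<in>F. ennreal (l (x - t k) * \<bar>x - t k\<bar> powr \<beta>))"
      using l_ge by (subst sum_ennreal) auto
    also have "\<dots> \<le> (\<Sum>k\<in>F. ennreal (L (exp (- t k) * exp x) * \<bar>ln (exp x) - t k\<bar> powr \<beta>))"
    proof (intro sum_mono ennreal_leI)
      fix k
      have "exp (- t k) * exp x = exp (x - t k)" by (simp flip: exp_add)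
      then show "l (x - t k) * \<bar>x - t k\<bar> powr \<beta> \<le> L (exp (- t k) * exp x) * \<bar>ln (exp x) - t k\<bar> powr \<beta>"
        using mult_right_mono[OF l_le[of "x - t k"], of "\<bar>x - t k\<bar> powr \<beta>"] by simp
    qed
    also have "\<dots> \<le> (\<Sum>\<^sub>\<infinity>k\<in>UNIV. ennreal (L (exp (- t k) * exp x) * \<bar>ln (exp x) - t k\<bar> powr \<beta>))"
      using that by (subst nonneg_infsum_complete) (auto intro!: SUP_upper)
    also have "\<dots> \<le> abs_moment \<beta> t L"
      unfolding abs_moment_def by (rule SUP_upper) simp
    also have "\<dots> = ennreal M" using mom by (simp add: M_def)
    finally show ?thesis by (simp add: M_def ennreal_le_iff)
  qed
  obtain A where A: "1 \<le> A" "\<And>x F. finite F \<Longrightarrow> (\<Sum>k\<in>F. l (x - t k)) \<le> A"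
    using sum_envelope_bounded[OF \<delta> gap l_ge B \<beta> M] by blast

  obtain a0 where a0: "0 < a0" and f_mod: "modular (\<lambda>u. \<phi> u + \<eta> u) (\<lambda>x. a0 * f x) < \<infinity>"
    and f_meas: "f \<in> borel_measurable haar"
    using assms(8) unfolding mellin_orlicz_def by blast
  obtain g where g [measurable]: "g \<in> borel_measurable borel" and g_eq: "AE s in lborel. f (exp s) = g s"
    using haar_borel_representative[OF f_meas] by blast
  have \<phi>_meas [measurable]: "(\<lambda>x. \<phi> \<bar>x\<bar>) \<in> borel_measurable borel"
    and \<eta>_meas [measurable]: "(\<lambda>x. \<eta> \<bar>x\<bar>) \<in> borel_measurable borel"
    using phi_abs_measurable \<phi>(1) \<eta>(1) by auto
  have fin: "(\<integral>\<^sup>+ s. ennreal (\<phi> \<bar>a0 * g s\<bar> + \<eta> \<bar>a0 * g s\<bar>) \<partial>lborel) < \<infinity>"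
  proof -
    have "AE x in haar. ennreal (\<phi> \<bar>a0 * g (ln x)\<bar> + \<eta> \<bar>a0 * g (ln x)\<bar>) = ennreal (\<phi> \<bar>a0 * f x\<bar> + \<eta> \<bar>a0 * f x\<bar>)"
      unfolding AE_haar_iff using g_eq by eventually_elim simp
    then have "(\<integral>\<^sup>+ x. ennreal (\<phi> \<bar>a0 * g (ln x)\<bar> + \<eta> \<bar>a0 * g (ln x)\<bar>) \<partial>haar)
        = modular (\<lambda>u. \<phi> u + \<eta> u) (\<lambda>x. a0 * f x)"
      unfolding modular_def by (rule nn_integral_cong_AE)
    then show ?thesis
      using f_mod nn_integral_haar_ln[of "\<lambda>s. ennreal (\<phi> \<bar>a0 * g s\<bar> + \<eta> \<bar>a0 * g s\<bar>)"] by simp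
  qed

  \<comment> \<open>\<open>a < 1\<close> is needed for the growth condition linking
    \<open>\<phi>\<close>, \<open>\<psi>\<close> and \<open>\<eta>\<close>, and
    \<open>2 * a \<le> a0\<close> for the integrability of \<open>H\<close>.\<close>
  define a where "a = min a0 1 / 2"
  have a: "0 < a" "a < 1" "2 * a \<le> a0" using a0 by (auto simp: a_def)
  obtain C where C: "0 < C" "\<And>u. 0 \<le> u \<Longrightarrow> \<phi> (C * \<psi> u) \<le> \<eta> (a * u)"
    using assms(7) a(1,2) by (meson greaterThanLessThan_iff)
  \<comment> \<open>Midpoint convexity is used twice, each time at the cost of a factor 2: to
    separate the two parts of the error, and to separate the two summands of
    \<open>Y\<close>.\<close>
  define c where "c = min (C / (4 * A)) (a0 / 4)"
  have c: "0 < c" "4 * c * A \<le> C" "4 * c \<le> a0"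
  proof -
    show "0 < c" using C(1) A(1) a0 by (simp add: c_def)
    have "c \<le> C / (4 * A)" by (simp add: c_def)
    then show "4 * c * A \<le> C" using A(1) by (simp add: field_simps)
    show "4 * c \<le> a0" by (simp add: c_def)
  qed

  \<comment> \<open>The factor 2 compensates the halved difference in
    \<open>phi_half_diff_le\<close>, so that oscillations of \<open>g\<close> are controlled at
    scale \<open>a\<close>.\<close>
  define H where "H s = sgn (2 * a * g s) * \<eta> \<bar>2 * a * g s\<bar>" for s
  have [measurable]: "H \<in> borel_measurable borel" unfolding H_def by measurable
  have H: "integrable lborel H"
    unfolding integrable_iff_bounded
  proof
    have "norm (H s) \<le> \<phi> \<bar>a0 * g s\<bar> + \<eta> \<bar>a0 * g s\<bar>" for s
    proof -
      have "norm (H s) = \<bar>sgn (2 * a * g s)\<bar> * \<eta> \<bar>2 * a * g s\<bar>"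
        using eta(3) by (simp add: H_def abs_mult)
      also have "\<dots> \<le> 1 * \<eta> \<bar>2 * a * g s\<bar>"
        using eta(3) by (intro mult_right_mono) (auto simp: sgn_if)
      also have "\<eta> \<bar>2 * a * g s\<bar> \<le> \<eta> \<bar>a0 * g s\<bar>"
        using a a0 by (intro eta(2)) (auto simp: abs_mult intro!: mult_right_mono)
      finally show ?thesis using phi(3)[of "\<bar>a0 * g s\<bar>"] by simp
    qed
    then have "(\<integral>\<^sup>+ s. ennreal (norm (H s)) \<partial>lborel) \<le> (\<integral>\<^sup>+ s. ennreal (\<phi> \<bar>a0 * g s\<bar> + \<eta> \<bar>a0 * g s\<bar>) \<partial>lborel)"
      by (intro nn_integral_mono ennreal_leI)
    then show "(\<integral>\<^sup>+ s. ennreal (norm (H s)) \<partial>lborel) < \<infinity>" using fin by order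
  qed simp
  have H_osc: "\<eta> (a * \<bar>g u - g s\<bar>) \<le> \<bar>H u - H s\<bar>" for u s
  proof -
    have "a * \<bar>g u - g s\<bar> = \<bar>2 * a * g u - 2 * a * g s\<bar> / 2"
      using a(1) by (simp add: abs_mult flip: right_diff_distrib)
    then show ?thesis
      unfolding H_def using phi_half_diff_le[OF \<eta>, of "2 * a * g u" "2 * a * g s"] by metis
  qed

  \<comment> \<open>Bounds the kernel error at a fixed value \<open>u \<ge> 0\<close>: the discrete
    sum is at most \<open>A * \<psi> u\<close> in absolute value, and \<open>u\<close> itself is
    subtracted.\<close>
  define Y where "Y u = A * \<psi> u + u" for u
  have Y: "continuous_on {0..} Y" "\<And>u. 0 \<le> u \<Longrightarrow> 0 \<le> Y u"
    using \<psi>_cont \<psi>0 A(1) unfolding Y_def by (auto intro!: continuous_intros add_nonneg_nonneg)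
  have Y_fin: "(\<integral>\<^sup>+ s. ennreal (\<phi> (2 * c * Y \<bar>g s\<bar>)) \<partial>lborel) < \<infinity>"
  proof -
    have "\<phi> (2 * c * Y \<bar>g s\<bar>) \<le> \<phi> \<bar>a0 * g s\<bar> + \<eta> \<bar>a0 * g s\<bar>" for s
    proof -
      let ?u = "\<bar>g s\<bar>"
      have "2 * c * Y ?u = (4 * c * A * \<psi> ?u + 4 * c * ?u) / 2"
        by (simp add: Y_def algebra_simps)
      also have "\<phi> \<dots> \<le> (\<phi> (4 * c * A * \<psi> ?u) + \<phi> (4 * c * ?u)) / 2"
        using c A(1) \<psi>0 by (intro convex_half_sum_le[OF \<phi>(2)]) auto
      also have "\<dots> \<le> \<phi> (4 * c * A * \<psi> ?u) + \<phi> (4 * c * ?u)"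
        using phi(3)[of "4 * c * A * \<psi> ?u"] phi(3)[of "4 * c * ?u"] c A(1) \<psi>0 by simp
      also have "\<phi> (4 * c * A * \<psi> ?u) \<le> \<phi> (C * \<psi> ?u)"
        using c A(1) \<psi>0 by (intro phi(2) mult_right_mono) auto
      also have "\<phi> (C * \<psi> ?u) \<le> \<eta> (a * ?u)" by (rule C(2)) simp
      also have "\<eta> (a * ?u) \<le> \<eta> \<bar>a0 * g s\<bar>"
        using a a0 by (intro eta(2)) (auto simp: abs_mult intro!: mult_right_mono)
      also have "\<phi> (4 * c * ?u) \<le> \<phi> \<bar>a0 * g s\<bar>"
        using c a0 by (intro phi(2)) (auto simp: abs_mult intro!: mult_right_mono)
      finally show ?thesis by simp
    qed
    then have "(\<integral>\<^sup>+ s. ennreal (\<phi> (2 * c * Y \<bar>g s\<bar>)) \<partial>lborel)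
        \<le> (\<integral>\<^sup>+ s. ennreal (\<phi> \<bar>a0 * g s\<bar> + \<eta> \<bar>a0 * g s\<bar>) \<partial>lborel)"
      by (intro nn_integral_mono ennreal_leI)
    then show ?thesis using fin by order
  qed
  obtain D where D: "0 \<le> D" "\<forall>\<^sub>F w in at_top. \<forall>x>0. \<forall>u.
    \<bar>(\<Sum>\<^sub>\<infinity>k\<in>UNIV. \<kappa> (exp (- t k) * x powr w) u) - u\<bar> \<le> D * (1 + \<bar>u\<bar>) * w powr - \<alpha>"
    using uniform_kernel_error[OF err] by blast
  \<comment> \<open>Combines the majorant \<open>Y\<close>, valid for all positive \<open>w\<close>,
    with the decay rate, valid for large \<open>w\<close>.\<close>
  define E where "E w s = min (Y \<bar>g s\<bar>) (D * (1 + \<bar>g s\<bar>) * w powr - \<alpha>)" for w s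
  have E_lim: "((\<lambda>w. \<integral>\<^sup>+ s. ennreal (\<phi> (2 * c * E w s)) \<partial>lborel) \<longlongrightarrow> 0) at_top"
    unfolding E_def by (rule phi_error_tendsto_0[OF \<phi>(1) \<alpha> _ D(1) g Y Y_fin]) (use c in simp)

  let ?osc = "oscillation t l H"
  have osc_lim: "(?osc \<longlongrightarrow> 0) at_top"
    by (rule oscillation_tendsto_0[OF \<delta> gap l_ge B \<beta> M H l_int])

  have bound: "modular \<phi> (\<lambda>x. c * (kantorovich t \<kappa> w f x - f x))
      \<le> ?osc w + (\<integral>\<^sup>+ s. ennreal (\<phi> (2 * c * E w s)) \<partial>lborel)"
    if w: "0 < w" and Dw: "\<forall>x>0. \<forall>u.
      \<bar>(\<Sum>\<^sub>\<infinity>k\<in>UNIV. \<kappa> (exp (- t k) * x powr w) u) - u\<bar> \<le> D * (1 + \<bar>u\<bar>) * w powr - \<alpha>" for w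
  proof -
    define mean where "mean k = w / (t (k + 1) - t k) * (LINT u:{t k / w..t (k + 1) / w}|lborel. g u)" for k
    define J where "J s = (\<integral>\<^sup>+ k. ennreal (l (w * s - t k)) *
      (\<integral>\<^sup>+ u. cell_average_weight t w k u * ennreal \<bar>H u - H s\<bar> \<partial>lborel) \<partial>count_space UNIV)" for s
    have [measurable]: "cell_average_weight t w k \<in> borel_measurable borel" for k
      unfolding cell_average_weight_def[abs_def] by measurable
    have J_meas [measurable]: "J \<in> borel_measurable borel" unfolding J_def by measurable
    have E0: "0 \<le> E w s" for s using Y(2) D(1) by (simp add: E_def)
    have [measurable]: "(\<lambda>s. Y \<bar>g s\<bar>) \<in> borel_measurable borel"
    proof -
      have "(\<lambda>x. Y \<bar>x\<bar>) \<in> borel_measurable borel"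
        by (intro borel_measurable_continuous_onI continuous_on_compose2[OF Y(1)] continuous_intros) auto
      then show ?thesis by measurable
    qed
    have E_meas [measurable]: "(\<lambda>s. \<phi> (2 * c * E w s)) \<in> borel_measurable borel"
    proof -
      have [measurable]: "(\<lambda>s. E w s) \<in> borel_measurable borel" unfolding E_def by measurable
      have "(\<lambda>s. \<phi> \<bar>2 * c * E w s\<bar>) \<in> borel_measurable borel" by measurable
      then show ?thesis using E0 c(1) by (simp add: abs_mult)
    qed
    \<comment> \<open>At \<open>exp s\<close> the kernel arguments become
      \<open>exp (w * s - t k)\<close>, and changing \<open>f\<close> on a null set leaves every
      local mean unchanged.\<close>
    have kant: "kantorovich t \<kappa> w f (exp s) = (\<Sum>\<^sub>\<infinity>k\<in>UNIV. \<kappa> (exp (w * s - t k)) (mean k))" for s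
    proof -
      have "exp (- t k) * exp s powr w = exp (w * s - t k)" for k
        by (simp add: exp_powr_real mult.commute flip: exp_add)
      moreover have "(LINT u:{t k / w..t (k + 1) / w}|lebesgue. f (exp u))
          = (LINT u:{t k / w..t (k + 1) / w}|lborel. g u)" for k
        by (rule set_lebesgue_integral_AE_lborel[OF g g_eq])
      ultimately show ?thesis unfolding kantorovich_def mean_def by simp
    qed
    have mean_le: "ennreal (\<eta> (a * \<bar>mean k - g s\<bar>))
        \<le> (\<integral>\<^sup>+ u. cell_average_weight t w k u * ennreal \<bar>H u - H s\<bar> \<partial>lborel)" for k s
    proof -
      have "t k / w < t (k + 1) / w" using gap(1)[of k] \<delta> w by (simp add: divide_strict_right_mono)
      from phi_mean_le[OF \<eta> a(1) this g, of "g s"]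
      have "ennreal (\<eta> (a * \<bar>mean k - g s\<bar>)) \<le> (\<integral>\<^sup>+ u. cell_average_weight t w k u * ennreal (\<eta> (a * \<bar>g u - g s\<bar>)) \<partial>lborel)"
        by (simp add: mean_def cell_average_weight_def flip: diff_divide_distrib)
      also have "\<dots> \<le> (\<integral>\<^sup>+ u. cell_average_weight t w k u * ennreal \<bar>H u - H s\<bar> \<partial>lborel)"
        by (intro nn_integral_mono mult_left_mono ennreal_leI H_osc) auto
      finally show ?thesis .
    qed
    \<comment> \<open>There are countably many nodes, so outside one null set the envelope agrees
      with \<open>L\<close> at all of them simultaneously.\<close>
    have "AE s in lborel. \<forall>k. L (exp (w * s - t k)) = l (w * s - t k)"
      unfolding AE_all_countable
    proof
      fix k
      show "AE s in lborel. L (exp (w * s - t k)) = l (w * s - t k)"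
        using AE_lborel_affine[OF l_eq, of w "- t k"] w by (simp add: algebra_simps)
    qed
    then have "AE s in lborel. ennreal (\<phi> \<bar>c * (kantorovich t \<kappa> w f (exp s) - f (exp s))\<bar>)
        \<le> J s + ennreal (\<phi> (2 * c * E w s))"
      using g_eq
    proof eventually_elim
      case (elim s)
      show ?case
      \<comment> \<open>Where \<open>J s\<close> is infinite the estimate is trivial; where it is
        finite, it forces the series of differences \<open>z\<close> to converge.\<close>
      proof (cases "J s = \<infinity>")
        case False
        let ?y = "g s"
        define z where "z k = \<kappa> (exp (w * s - t k)) (mean k) - \<kappa> (exp (w * s - t k)) ?y" for k
        let ?S = "\<Sum>\<^sub>\<infinity>k\<in>UNIV. \<kappa> (exp (w * s - t k)) ?y"
        let ?J = "\<integral>\<^sup>+ k. ennreal (l (w * s - t k)) * ennreal (\<eta> (a * \<bar>mean k - g s\<bar>)) \<partial>count_space UNIV"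
        have J: "?J \<le> J s"
          unfolding J_def by (intro nn_integral_mono mult_left_mono mean_le) auto
        then have J_fin: "?J < \<infinity>" using False by (simp add: less_top top_unique)
        have z_le: "\<bar>z k\<bar> \<le> l (w * s - t k) * \<psi> \<bar>mean k - g s\<bar>" for k
          using \<kappa>_lip[of "exp (w * s - t k)" "mean k" ?y] elim(1) by (simp add: z_def)
        have A': "sum (\<lambda>k. l (w * s - t k)) F \<le> A" if "finite F" for F using A(2)[OF that] .
        have c2: "0 < 2 * c" "2 * c * A \<le> C" using c C(1) by auto
        note zs = phi_sum_le[where \<phi>=\<phi> and \<eta>=\<eta> and \<psi>=\<psi> and C=C and a=a and A=A and c="2 * c"
            and l="\<lambda>k. l (w * s - t k)" and d="\<lambda>k. \<bar>mean k - g s\<bar>" and z=z,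
            OF \<phi> eta(3) C(2) \<psi>0 less_imp_le[OF a(1)] l_ge A(1) A' c2 abs_ge_zero z_le J_fin]
        have z_sum: "z summable_on UNIV" by (rule zs(1))
        have z_phi: "ennreal (\<phi> (2 * c * \<bar>infsum z UNIV\<bar>)) \<le> ?J" by (rule zs(2))
        have pw: "exp (- t k) * exp s powr w = exp (w * s - t k)" for k
          by (simp add: exp_powr_real mult.commute flip: exp_add)
        have S_abs: "(\<lambda>k. \<bar>\<kappa> (exp (w * s - t k)) ?y\<bar>) summable_on UNIV"
          using \<kappa>_summable[of "exp s" w ?y] w by (simp add: pw)
        then have S_sum: "(\<lambda>k. \<kappa> (exp (w * s - t k)) ?y) summable_on UNIV"
          using abs_summable_summable[of "\<lambda>k. \<kappa> (exp (w * s - t k)) ?y" UNIV] by simp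
        \<comment> \<open>Both series have to converge here: \<open>infsum\<close> has a default
          value otherwise and would not be additive.\<close>
        have K: "kantorovich t \<kappa> w f (exp s) = infsum z UNIV + ?S"
          unfolding kant using infsum_add[OF z_sum S_sum] by (simp add: z_def)
        \<comment> \<open>The Lipschitz-type condition against the value 0, where the kernel
          vanishes, bounds each term by the envelope.\<close>
        have "\<bar>?S\<bar> \<le> A * \<psi> \<bar>?y\<bar>"
        proof -
          have "\<bar>?S\<bar> \<le> (\<Sum>\<^sub>\<infinity>k\<in>UNIV. \<bar>\<kappa> (exp (w * s - t k)) ?y\<bar>)"
            using norm_infsum_bound[of "\<lambda>k. \<kappa> (exp (w * s - t k)) ?y" UNIV] S_abs by simp
          also have "\<dots> \<le> A * \<psi> \<bar>?y\<bar>"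
          proof (rule infsum_le_finite_sums[OF S_abs])
            fix F :: "int set" assume F: "finite F"
            have "(\<Sum>k\<in>F. \<bar>\<kappa> (exp (w * s - t k)) ?y\<bar>) \<le> (\<Sum>k\<in>F. l (w * s - t k) * \<psi> \<bar>?y\<bar>)"
            proof (rule sum_mono)
              fix k
              show "\<bar>\<kappa> (exp (w * s - t k)) ?y\<bar> \<le> l (w * s - t k) * \<psi> \<bar>?y\<bar>"
                using \<kappa>_lip[of "exp (w * s - t k)" ?y 0] \<kappa>_zero[of "exp (w * s - t k)"] elim(1) by simp
            qed
            also have "\<dots> = (\<Sum>k\<in>F. l (w * s - t k)) * \<psi> \<bar>?y\<bar>" by (simp add: sum_distrib_right)
            also have "\<dots> \<le> A * \<psi> \<bar>?y\<bar>" using A(2)[OF F] \<psi>0 by (intro mult_right_mono) auto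
            finally show "(\<Sum>k\<in>F. \<bar>\<kappa> (exp (w * s - t k)) ?y\<bar>) \<le> A * \<psi> \<bar>?y\<bar>" .
          qed
          finally show ?thesis .
        qed
        then have "\<bar>?S - ?y\<bar> \<le> Y \<bar>?y\<bar>" unfolding Y_def by linarith
        moreover have "\<bar>?S - ?y\<bar> \<le> D * (1 + \<bar>?y\<bar>) * w powr - \<alpha>"
          using Dw[rule_format, of "exp s" ?y] by (simp add: pw)
        ultimately have S_E: "\<bar>?S - ?y\<bar> \<le> E w s" by (simp add: E_def)
        have "\<phi> \<bar>c * (kantorovich t \<kappa> w f (exp s) - f (exp s))\<bar>
            \<le> \<phi> ((2 * c * \<bar>infsum z UNIV\<bar> + 2 * c * E w s) / 2)"
        proof (rule phi(2))
          have "\<bar>kantorovich t \<kappa> w f (exp s) - f (exp s)\<bar> \<le> \<bar>infsum z UNIV\<bar> + E w s"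
            using S_E unfolding K elim(2) by linarith
          then have "c * \<bar>kantorovich t \<kappa> w f (exp s) - f (exp s)\<bar> \<le> c * (\<bar>infsum z UNIV\<bar> + E w s)"
            using c(1) by (intro mult_left_mono) auto
          then show "\<bar>c * (kantorovich t \<kappa> w f (exp s) - f (exp s))\<bar>
              \<le> (2 * c * \<bar>infsum z UNIV\<bar> + 2 * c * E w s) / 2"
            using c(1) by (simp add: abs_mult distrib_left)
        qed simp
        also have "\<dots> \<le> (\<phi> (2 * c * \<bar>infsum z UNIV\<bar>) + \<phi> (2 * c * E w s)) / 2"
          using c(1) E0 by (intro convex_half_sum_le[OF \<phi>(2)]) auto
        also have "\<dots> \<le> \<phi> (2 * c * \<bar>infsum z UNIV\<bar>) + \<phi> (2 * c * E w s)"
          using phi(3)[of "2 * c * \<bar>infsum z UNIV\<bar>"] phi(3)[of "2 * c * E w s"] c(1) E0[of s] by simp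
        finally have "ennreal (\<phi> \<bar>c * (kantorovich t \<kappa> w f (exp s) - f (exp s))\<bar>)
            \<le> ennreal (\<phi> (2 * c * \<bar>infsum z UNIV\<bar>)) + ennreal (\<phi> (2 * c * E w s))"
          using phi(3)[of "2 * c * \<bar>infsum z UNIV\<bar>"] phi(3)[of "2 * c * E w s"] c(1) E0[of s]
          by (simp add: ennreal_leI flip: ennreal_plus)
        also have "\<dots> \<le> J s + ennreal (\<phi> (2 * c * E w s))"
          by (rule add_right_mono) (rule order_trans[OF z_phi J])
        finally show ?thesis .
      qed simp
    qed
    then have "AE x in haar. ennreal (\<phi> \<bar>c * (kantorovich t \<kappa> w f x - f x)\<bar>)
        \<le> J (ln x) + ennreal (\<phi> (2 * c * E w (ln x)))"
      unfolding AE_haar_iff by simp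
    \<comment> \<open>Monotonicity of the integral holds for an arbitrary integrand on the left. The
      change of variable is then made only in the Borel majorant.\<close>
    then have "modular \<phi> (\<lambda>x. c * (kantorovich t \<kappa> w f x - f x))
        \<le> (\<integral>\<^sup>+ x. J (ln x) + ennreal (\<phi> (2 * c * E w (ln x))) \<partial>haar)"
      unfolding modular_def by (rule nn_integral_mono_AE)
    also have "\<dots> = (\<integral>\<^sup>+ s. J s + ennreal (\<phi> (2 * c * E w s)) \<partial>lborel)"
      using nn_integral_haar_ln[of "\<lambda>s. J s + ennreal (\<phi> (2 * c * E w s))"] by simp
    also have "\<dots> = (\<integral>\<^sup>+ s. J s \<partial>lborel) + (\<integral>\<^sup>+ s. ennreal (\<phi> (2 * c * E w s)) \<partial>lborel)"
      by (rule nn_integral_add) auto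
    also have "(\<integral>\<^sup>+ s. J s \<partial>lborel) = ?osc w"
      by (simp add: J_def[abs_def] oscillation_def)
    finally show ?thesis .
  qed
  have "((\<lambda>w. modular \<phi> (\<lambda>x. c * (kantorovich t \<kappa> w f x - f x))) \<longlongrightarrow> 0) at_top"
  proof (rule tendsto_sandwich[OF _ _ tendsto_const])
    show "\<forall>\<^sub>F w in at_top. modular \<phi> (\<lambda>x. c * (kantorovich t \<kappa> w f x - f x))
        \<le> ?osc w + (\<integral>\<^sup>+ s. ennreal (\<phi> (2 * c * E w s)) \<partial>lborel)"
      using D(2) eventually_gt_at_top[of 0] by eventually_elim (rule bound)
    show "((\<lambda>w. ?osc w + (\<integral>\<^sup>+ s. ennreal (\<phi> (2 * c * E w s)) \<partial>lborel)) \<longlongrightarrow> 0) at_top"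
      using tendsto_add[OF osc_lim E_lim] by simp
  qed simp
  then show ?thesis using c(1) by blast
qed

end
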